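(* Let $\Omega=\mathbb{R}^n_+=\{x\in\mathbb{R}^n:x_n>0\}$ and $1\le p\le\infty$ be such that $\alpha-1>\frac np$. Let $\frac32<\alpha<2$ and let $u\in H^{\alpha/2}_{(0)}(\Omega)\cap H^\alpha_{\mathrm{loc}}(\Omega)$ be a solution of $$\mathcal{E}(u,\psi)=\int_\Omega g\,\psi\,dx\qquad\text{for all }\psi\in H^{\alpha/2}_{(0)}(\Omega)$$ with $g\in L^p_{(0)}(\Omega)$. Suppose that $u\in C^{1,\beta}(\overline\Omega)$. For $x_0\in\partial\Omega$ and $\delta>0$ let $\varphi_\delta(x)=1-\frac{|x-x_0|}{\delta}$ if $|x-x_0|<\delta$ and $\varphi_\delta(x)=0$ otherwise. If $n\ge2$, assume that for every $x_0\in\partial\Omega$ the limit $$\mathbf{n}_{x_0}=\lim_{\delta\to0}\delta^{-1-n+\alpha}\int_\Omega\int_\Omega(x-y)(\varphi_\delta(x)-\varphi_\delta(y))\,k(x,y,x-y)\,dx\,dy$$ exists and is non-zero. If $n=1$, let $\mathbf{n}_{x_0}=1$. Then $$\nabla u(x_0)\cdot\mathbf{n}_{x_0}=0\qquad\text{for all }x_0\in\partial\Omega.$$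
   Context: The kernel $k\colon\mathbb{R}^n\times\mathbb{R}^n\times(\mathbb{R}^n\setminus\{0\})\to\mathbb{R}$ is $(n+2)$-times continuously differentiable and, for all $x,y,z\in\mathbb{R}^n$, $z\ne0$, and all multi-indices $\beta',\gamma,\delta'\in\mathbb{N}_0^n$ with $|\beta'|+|\gamma|+|\delta'|\le n+2$, satisfies $k(x,y,z)=k(y,x,-z)$; $|\partial_x^{\beta'}\partial_y^{\gamma}\partial_z^{\delta'}k(x,y,z)|\le C_{\beta',\gamma,\delta'}|z|^{-n-\alpha-|\delta'|}$; and $k_0|z|^{-n-\alpha}\le k(x,y,z)\le K_0|z|^{-n-\alpha}$ with constants $0<k_0\le K_0$. $\mathcal{E}(u,v)=\frac12\int_\Omega\int_\Omega(u(x)-u(y))(v(x)-v(y))k(x,y,x-y)\,dx\,dy$ for $u,v\in H^{\alpha/2}(\Omega)$, where $H^{s}(\Omega)$, $0<s<1$, has norm given by $\|u\|_{H^s}^2=\|u\|_{L^2}^2+\int_\Omega\int_\Omega\frac{|u(x)-u(y)|^2}{|x-y|^{n+2s}}dx\,dy$. $H^\alpha_{\mathrm{loc}}(\Omega)$ is the space of functions that are locally in the $L^2$-Sobolev space of order $\alpha$ in the interior of $\Omega$. The subscript $(0)$ on a function space denotes its elements of mean value zero, $m(f)=0$, where $m(f)=\frac1{|\Omega|}\int_\Omega f\,dx$. This notation is introduced for bounded domains and is used formally for the half-space, which serves as a model for a bounded smooth domain. The weak equation is regarded as holding also for all $\psi\in H^{\alpha/2}(\Omega)$, on the ground that $m(g)=0$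 and both sides vanish on constants. $C^{1,\beta}(\overline\Omega)$, $\beta\in(0,1)$, is the space of functions that are bounded and continuously differentiable up to the boundary with bounded, $\beta$-Hölder continuous gradient. *)

theory Defs
  imports "HOL-Analysis.Analysis"
begin

section \<open>Derivatives, multi-indices, \<open>C\<^sup>m\<close> functions\<close>

definition partial :: "'a::euclidean_space \<Rightarrow> ('a \<Rightarrow> real) \<Rightarrow> 'a \<Rightarrow> real" where
  "partial b f x = deriv (\<lambda>t::real. f (x + t *\<^sub>R b)) 0"

primrec Ck :: "nat \<Rightarrow> 'a::euclidean_space set \<Rightarrow> ('a \<Rightarrow> real) \<Rightarrow> bool" where
  "Ck 0 U f \<longleftrightarrow> continuous_on U f"
| "Ck (Suc m) U f \<longleftrightarrow> continuous_on U f \<and>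
     (\<forall>b\<in>Basis. (\<forall>x\<in>U. (\<lambda>t::real. f (x + t *\<^sub>R b)) differentiable (at 0)) \<and> Ck m U (partial b f))"

text \<open>
  A multi-index is a function \<open>\<beta> :: 'n \<Rightarrow> nat\<close>. The coordinates are numbered by the linear order
  on \<open>'n\<close>, and \<open>e i\<close> is the direction belonging to the \<open>i\<close>-th coordinate; this makes it possible
  to differentiate in one block of variables of a function on a product space.
\<close>

definition multi_partial ::
    "('n::{finite,linorder} \<Rightarrow> 'a::euclidean_space) \<Rightarrow> ('n \<Rightarrow> nat) \<Rightarrow> ('a \<Rightarrow> real) \<Rightarrow> 'a \<Rightarrow> real" where
  "multi_partial e \<beta> f = foldr (\<lambda>i. partial (e i) ^^ \<beta> i) (sorted_list_of_set UNIV) f"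

definition msize :: "('n::finite \<Rightarrow> nat) \<Rightarrow> nat" where
  "msize \<beta> = (\<Sum>i\<in>UNIV. \<beta> i)"

definition grad :: "('a::euclidean_space \<Rightarrow> real) \<Rightarrow> 'a \<Rightarrow> 'a" where
  "grad f x = (THE D. GDERIV f x :> D)"


section \<open>The kernel\<close>

definition admissible_kernel ::
    "real \<Rightarrow> (real^'n::{finite,linorder} \<Rightarrow> real^'n::{finite,linorder} \<Rightarrow> real^'n::{finite,linorder} \<Rightarrow> real) \<Rightarrow> bool" where
  "admissible_kernel \<alpha> k \<longleftrightarrow>
     (let n = CARD('n);
          K = (\<lambda>(x, y, z). k x y z);
          D = (\<lambda>\<beta> \<gamma> \<delta>. multi_partial (\<lambda>i. (axis i 1, 0, 0)) \<beta>
                        (multi_partial (\<lambda>i. (0, axis i 1, 0)) \<gamma>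
                          (multi_partial (\<lambda>i. (0, 0, axis i 1)) \<delta> K)))
      in Ck (n + 2) (UNIV \<times> UNIV \<times> (- {0})) K \<and>
         (\<forall>x y z. z \<noteq> 0 \<longrightarrow> k x y z = k y x (- z)) \<and>
         (\<exists>C. \<forall>\<beta> \<gamma> \<delta>. msize \<beta> + msize \<gamma> + msize \<delta> \<le> n + 2 \<longrightarrow>
            (\<forall>x y z. z \<noteq> 0 \<longrightarrow>
               \<bar>D \<beta> \<gamma> \<delta> (x, y, z)\<bar> \<le> C \<beta> \<gamma> \<delta> * norm z powr (- real n - \<alpha> - real (msize \<delta>)))) \<and>
         (\<exists>k0 K0. 0 < k0 \<and> k0 \<le> K0 \<and>
            (\<forall>x y z. z \<noteq> 0 \<longrightarrow>
               k0 * norm z powr (- real n - \<alpha>) \<le> k x y z \<and>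
               k x y z \<le> K0 * norm z powr (- real n - \<alpha>))))"

definition energy_form ::
    "(real^'n::finite) set \<Rightarrow> (real^'n \<Rightarrow> real^'n \<Rightarrow> real^'n \<Rightarrow> real) \<Rightarrow>
     (real^'n \<Rightarrow> real) \<Rightarrow> (real^'n \<Rightarrow> real) \<Rightarrow> real" where
  "energy_form \<Omega> k u v =
     1/2 * (LINT y|lebesgue_on \<Omega>. LINT x|lebesgue_on \<Omega>. (u x - u y) * (v x - v y) * k x y (x - y))"


section \<open>Function spaces\<close>

text \<open>
  Elements of \<open>Lp p \<Omega>\<close>, \<open>Hs s \<Omega>\<close>, ... are functions on the whole space; their values outside
  \<open>\<Omega>\<close> are irrelevant, and functions that agree almost everywhere are not identified.
\<close>

definition Lp :: "ereal \<Rightarrow> (real^'n::finite) set \<Rightarrow> (real^'n \<Rightarrow> real) set" where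
  "Lp p \<Omega> = {f \<in> borel_measurable (lebesgue_on \<Omega>).
      if p = \<infinity> then \<exists>C. AE x in lebesgue_on \<Omega>. \<bar>f x\<bar> \<le> C
      else integrable (lebesgue_on \<Omega>) (\<lambda>x. \<bar>f x\<bar> powr real_of_ereal p)}"

text \<open>\<open>H\<^sup>s(\<Omega>)\<close> for \<open>0 < s < 1\<close>. On the diagonal the integrand is \<open>0 / 0 = 0\<close>.\<close>

definition Hs :: "real \<Rightarrow> (real^'n::finite) set \<Rightarrow> (real^'n \<Rightarrow> real) set" where
  "Hs s \<Omega> = {u \<in> Lp 2 \<Omega>.
      (\<integral>\<^sup>+y. \<integral>\<^sup>+x. ennreal (\<bar>u x - u y\<bar>\<^sup>2 / norm (x - y) powr (real CARD('n) + 2 * s))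
         \<partial>lebesgue_on \<Omega> \<partial>lebesgue_on \<Omega>) < \<infinity>}"

definition test_functions :: "(real^'n::finite) set \<Rightarrow> (real^'n \<Rightarrow> real) set" where
  "test_functions V = {\<phi>. (\<forall>m. Ck m UNIV \<phi>) \<and>
      compact (closure {x. \<phi> x \<noteq> 0}) \<and> closure {x. \<phi> x \<noteq> 0} \<subseteq> V}"

definition weak_partial ::
    "(real^'n::finite) set \<Rightarrow> 'n \<Rightarrow> (real^'n \<Rightarrow> real) \<Rightarrow> (real^'n \<Rightarrow> real) \<Rightarrow> bool" where
  "weak_partial V i u v \<longleftrightarrow> (\<forall>\<phi>\<in>test_functions V.
      (LINT x|lebesgue_on V. u x * partial (axis i 1) \<phi> x) = - (LINT x|lebesgue_on V. v x * \<phi> x))"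

text \<open>
  \<open>H\<^sup>s(V)\<close> and \<open>H\<^sup>s\<^sub>l\<^sub>o\<^sub>c(\<Omega>)\<close> for \<open>1 < s < 2\<close> (Sobolev--Slobodeckij): the function lies in \<open>L\<^sup>2\<close>
  and its weak first-order derivatives lie in \<open>H\<close> of order \<open>s - 1\<close>.
\<close>

definition Hs1 :: "real \<Rightarrow> (real^'n::finite) set \<Rightarrow> (real^'n \<Rightarrow> real) set" where
  "Hs1 s V = {u \<in> Lp 2 V. \<forall>i. \<exists>v\<in>Hs (s - 1) V. weak_partial V i u v}"

definition Hs1_loc :: "real \<Rightarrow> (real^'n::finite) set \<Rightarrow> (real^'n \<Rightarrow> real) set" where
  "Hs1_loc s \<Omega> = {u. \<forall>V. open V \<and> compact (closure V) \<and> closure V \<subseteq> \<Omega> \<longrightarrow> u \<in> Hs1 s V}"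

text \<open>
  For \<open>\<Omega>\<close> open. That \<open>u\<close> and its gradient are continuous up to the boundary is expressed by the
  existence of their limits at the boundary points, so that the values of the total function
  \<open>u\<close> on the boundary do not matter.
\<close>

definition C1_hoelder :: "real \<Rightarrow> (real^'n::finite) set \<Rightarrow> (real^'n \<Rightarrow> real) set" where
  "C1_hoelder \<beta> \<Omega> = {u.
      (\<forall>x\<in>\<Omega>. GDERIV u x :> grad u x) \<and>
      (\<forall>x\<^sub>0\<in>frontier \<Omega>. (\<exists>l. (u \<longlongrightarrow> l) (at x\<^sub>0 within \<Omega>)) \<and> (\<exists>l. (grad u \<longlongrightarrow> l) (at x\<^sub>0 within \<Omega>))) \<and>
      bounded (u ` \<Omega>) \<and> bounded (grad u ` \<Omega>) \<and>
      (\<exists>C. \<forall>x\<in>\<Omega>. \<forall>y\<in>\<Omega>. norm (grad u x - grad u y) \<le> C * norm (x - y) powr \<beta>)}"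

definition boundary_grad :: "(real^'n::finite) set \<Rightarrow> (real^'n \<Rightarrow> real) \<Rightarrow> real^'n \<Rightarrow> real^'n" where
  "boundary_grad \<Omega> u x\<^sub>0 = Lim (at x\<^sub>0 within \<Omega>) (grad u)"


section \<open>Mean value zero\<close>

text \<open>
  On a bounded domain, an integrable \<open>f\<close> has mean value zero iff its integral vanishes. On a domain
  of infinite measure there are two natural substitutes: the averages of \<open>f\<close> over
  the truncated domains tend to zero (\<open>zero_mean\<close>), or \<open>f\<close> is integrable with integral zero
  (\<open>zero_integral\<close>). For integrable \<open>f\<close>, both agree with the usual notion if the domain is bounded, and the second
  implies the first, see the lemmas below. Every \<open>f\<close> in \<open>L\<^sup>p\<close> of the half-space with
  \<open>p < \<infinity>\<close> satisfies the first one, whereas a nonzero constant does not. Requiring only the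
  first of given data, and testing a weak equation only against functions with the
  second, gives the weakest hypotheses, which are implied by either reading.
\<close>

definition zero_mean :: "(real^'n::finite) set \<Rightarrow> (real^'n \<Rightarrow> real) \<Rightarrow> bool" where
  "zero_mean \<Omega> f \<longleftrightarrow>
     ((\<lambda>R. (LINT x|lebesgue_on (\<Omega> \<inter> ball 0 R). f x) / measure lebesgue (\<Omega> \<inter> ball 0 R)) \<longlongrightarrow> 0) at_top"

definition zero_integral :: "(real^'n::finite) set \<Rightarrow> (real^'n \<Rightarrow> real) \<Rightarrow> bool" where
  "zero_integral \<Omega> f \<longleftrightarrow> integrable (lebesgue_on \<Omega>) f \<and> (LINT x|lebesgue_on \<Omega>. f x) = 0"

lemma zero_mean_iff_bounded:
  fixes \<Omega> :: "(real^'n::finite) set"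
  assumes "bounded \<Omega>" and "measure lebesgue \<Omega> \<noteq> 0" and "integrable (lebesgue_on \<Omega>) f"
  shows "zero_mean \<Omega> f \<longleftrightarrow> zero_integral \<Omega> f"
proof -
  obtain B where B: "\<And>x. x \<in> \<Omega> \<Longrightarrow> norm x \<le> B"
    using assms(1) by (auto simp: bounded_iff)
  have "\<forall>\<^sub>F R in at_top. \<Omega> \<inter> ball 0 R = \<Omega>"
    using eventually_gt_at_top[of B] by eventually_elim (use B in force)
  then have "zero_mean \<Omega> f \<longleftrightarrow>
      ((\<lambda>R::real. (LINT x|lebesgue_on \<Omega>. f x) / measure lebesgue \<Omega>) \<longlongrightarrow> 0) at_top"
    unfolding zero_mean_def by (intro tendsto_cong) (auto elim: eventually_mono)
  also have "\<dots> \<longleftrightarrow> (LINT x|lebesgue_on \<Omega>. f x) = 0"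
    using assms(2) by (simp add: tendsto_const_iff)
  finally show ?thesis
    using assms(3) by (simp add: zero_integral_def)
qed

lemma zero_integral_imp_zero_mean:
  fixes \<Omega> :: "(real^'n::finite) set"
  assumes "open \<Omega>" and "\<Omega> \<noteq> {}" and f: "zero_integral \<Omega> f"
  shows "zero_mean \<Omega> f"
proof -
  have [measurable]: "\<Omega> \<in> sets lebesgue" "ball (0::real^'n) R \<in> sets lebesgue" for R
    using assms(1) by auto
  define m where "m R = measure lebesgue (\<Omega> \<inter> ball 0 R)" for R
  have fin: "\<Omega> \<inter> ball 0 R \<in> lmeasurable" for R
    using assms(1) by (intro lmeasurable_open) (auto intro: bounded_subset[OF bounded_ball])
  have int: "integrable lebesgue (\<lambda>x. indicator \<Omega> x *\<^sub>R f x)" and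
    "(LINT x|lebesgue. indicator \<Omega> x *\<^sub>R f x) = 0"
    using f unfolding zero_integral_def
    by (auto simp: integrable_restrict_space integral_restrict_space)
  have "((\<lambda>R. LINT x|lebesgue. indicator (ball 0 R) x *\<^sub>R (indicator \<Omega> x *\<^sub>R f x)) \<longlongrightarrow>
      (LINT x|lebesgue. indicator \<Omega> x *\<^sub>R f x)) at_top"
  proof (rule integral_dominated_convergence_at_top[where w = "\<lambda>x. \<bar>indicator \<Omega> x *\<^sub>R f x\<bar>"])
    show "AE x in lebesgue. ((\<lambda>R. indicator (ball 0 R) x *\<^sub>R (indicator \<Omega> x *\<^sub>R f x)) \<longlongrightarrow>
        indicator \<Omega> x *\<^sub>R f x) at_top"
    proof (rule AE_I2)
      fix x :: "real^'n"
      have "\<forall>\<^sub>F R in at_top. indicator (ball 0 R) x *\<^sub>R (indicator \<Omega> x *\<^sub>R f x) = indicator \<Omega> x *\<^sub>R f x"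
        using eventually_gt_at_top[of "norm x"] by eventually_elim auto
      then show "((\<lambda>R. indicator (ball 0 R) x *\<^sub>R (indicator \<Omega> x *\<^sub>R f x)) \<longlongrightarrow>
          indicator \<Omega> x *\<^sub>R f x) at_top"
        by (rule tendsto_eventually)
    qed
  next
    show "(\<lambda>x. indicator (ball 0 R) x *\<^sub>R (indicator \<Omega> x *\<^sub>R f x)) \<in> borel_measurable lebesgue" for R
      by (intro borel_measurable_scaleR borel_measurable_indicator borel_measurable_integrable[OF int]) auto
  qed (use int in \<open>auto simp: indicator_def intro!: always_eventually\<close>)
  moreover have "(LINT x|lebesgue. indicator (ball 0 R) x *\<^sub>R (indicator \<Omega> x *\<^sub>R f x))
      = (LINT x|lebesgue_on (\<Omega> \<inter> ball 0 R). f x)" for R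
    by (subst integral_restrict_space) (auto intro!: Bochner_Integration.integral_cong simp: indicator_def)
  ultimately have lim: "((\<lambda>R. LINT x|lebesgue_on (\<Omega> \<inter> ball 0 R). f x) \<longlongrightarrow> 0) at_top"
    using \<open>(LINT x|lebesgue. indicator \<Omega> x *\<^sub>R f x) = 0\<close> by simp
  obtain a where a: "a \<in> \<Omega>" using assms(2) by auto
  define R0 where "R0 = norm a + 1"
  have "open (\<Omega> \<inter> ball 0 R0)" "\<Omega> \<inter> ball 0 R0 \<noteq> {}"
    using assms(1) a by (auto simp: R0_def)
  then have "\<not> negligible (\<Omega> \<inter> ball 0 R0)"
    using open_not_negligible by blast
  then have m0: "0 < m R0"
    unfolding m_def using fin[of R0] measure_nonneg[of lebesgue "\<Omega> \<inter> ball 0 R0"]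
    by (auto simp: negligible_iff_measure less_le)
  have mono: "m R0 \<le> m R" if "R0 \<le> R" for R
    unfolding m_def using that fin by (intro measure_mono_fmeasurable) auto
  have "((\<lambda>R. (LINT x|lebesgue_on (\<Omega> \<inter> ball 0 R). f x) / m R) \<longlongrightarrow> 0) at_top"
  proof (rule Lim_null_comparison[where g = "\<lambda>R. \<bar>LINT x|lebesgue_on (\<Omega> \<inter> ball 0 R). f x\<bar> / m R0"])
    show "\<forall>\<^sub>F R in at_top. norm ((LINT x|lebesgue_on (\<Omega> \<inter> ball 0 R). f x) / m R)
        \<le> \<bar>LINT x|lebesgue_on (\<Omega> \<inter> ball 0 R). f x\<bar> / m R0"
      using eventually_ge_at_top[of R0]
    proof eventually_elim
      case (elim R)
      with m0 mono[of R] show ?case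
        by (auto simp: abs_divide intro!: divide_left_mono mult_pos_pos)
    qed
    show "((\<lambda>R. \<bar>LINT x|lebesgue_on (\<Omega> \<inter> ball 0 R). f x\<bar> / m R0) \<longlongrightarrow> 0) at_top"
      using m0 by (auto intro!: tendsto_divide_zero tendsto_rabs_zero lim)
  qed
  then show ?thesis by (simp add: zero_mean_def m_def)
qed


section \<open>The half-space and the tent functions\<close>

definition half_space :: "(real^'n::{finite,linorder}) set" where
  "half_space = {x. 0 < x $ Max UNIV}"

definition tent :: "real^'n::finite \<Rightarrow> real \<Rightarrow> real^'n \<Rightarrow> real" where
  "tent x\<^sub>0 \<delta> x = (if norm (x - x\<^sub>0) < \<delta> then 1 - norm (x - x\<^sub>0) / \<delta> else 0)"

definition scaled_tent_moment ::
    "real \<Rightarrow> (real^'n::finite) set \<Rightarrow> (real^'n \<Rightarrow> real^'n \<Rightarrow> real^'n \<Rightarrow> real) \<Rightarrow>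
     real^'n \<Rightarrow> real \<Rightarrow> real^'n" where
  "scaled_tent_moment \<alpha> \<Omega> k x\<^sub>0 \<delta> =
     \<delta> powr (- 1 - real CARD('n) + \<alpha>) *\<^sub>R
       (LINT y|lebesgue_on \<Omega>. LINT x|lebesgue_on \<Omega>.
          ((tent x\<^sub>0 \<delta> x - tent x\<^sub>0 \<delta> y) * k x y (x - y)) *\<^sub>R (x - y))"

end

theory Submission
  imports Defs
begin

text \<open>
  Write \<open>\<phi>\<^sub>\<delta>\<close> for the tent of radius \<open>\<delta>\<close> at \<open>x\<^sub>0\<close>, \<open>G\<close> for the boundary gradient there and \<open>n\<close> for the
  dimension. The idea is to test the weak equation with \<open>\<phi>\<^sub>\<delta>\<close> and to look at both sides at the
  scale \<open>\<delta>\<^bsup>n+1-\<alpha>\<^esup>\<close>, which is the size of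
  \<open>\<integral>\<integral> \<bar>x - y\<bar> \<bar>\<phi>\<^sub>\<delta>(x) - \<phi>\<^sub>\<delta>(y)\<bar> k(x, y, x - y) dx dy\<close>.

  The right-hand side is of lower order. By interpolation between a constant and \<open>\<bar>g\<bar>\<^sup>p\<close>,
  \<open>\<integral> g \<phi>\<^sub>\<delta> = O(\<delta>\<^bsup>n-n/p\<^esup>)\<close>, and \<open>n/p < \<alpha> - 1\<close> (\<open>Lp_tent_bound\<close>). The tent itself does not have
  integral zero, so the admissible test function is \<open>\<phi>\<^sub>\<delta> - c \<phi>\<^sub>1\<close> with \<open>c = \<integral> \<phi>\<^sub>\<delta> / \<integral> \<phi>\<^sub>1 = O(\<delta>\<^sup>n)\<close>;
  the correction costs only \<open>O(\<delta>\<^sup>n)\<close>, again of lower order because \<open>\<alpha> > 1\<close>. Hence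
  \<open>\<delta>\<^bsup>\<alpha>-1-n\<^esup> \<E>(u, \<phi>\<^sub>\<delta>) \<rightarrow> 0\<close> (\<open>weak_solution_tent_limit\<close>).

  On the left-hand side, \<open>u(x) - u(y)\<close> may be replaced by \<open>G \<bullet> (x - y)\<close>
  (\<open>kernel_form_linearisation_error\<close>). If \<open>x\<close> and \<open>y\<close> are both in a ball of radius \<open>r\<close> around \<open>x\<^sub>0\<close>, in
  which the gradient differs from \<open>G\<close> by at most \<open>\<epsilon>\<close>, the error is at most \<open>\<epsilon> \<bar>x - y\<bar>\<close>, and these pairs
  contribute \<open>O(\<epsilon> \<delta>\<^bsup>n+1-\<alpha>\<^esup>)\<close>. In the remaining pairs only those with one point in the small ball
  of radius \<open>\<delta>\<close> matter; their distance is at least \<open>r/2\<close>, and since \<open>\<bar>z\<bar>\<^bsup>1-n-\<alpha>\<^esup>\<close> is integrable at infinity,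
  they contribute \<open>O(\<delta>\<^sup>n)\<close>. All these estimates reduce to the scaling behaviour of the integral of one
  function on \<open>\<real>\<^sup>n\<close>, the function \<open>weight \<alpha> \<delta>\<close> below; it is finite exactly because \<open>1 < \<alpha> < 2\<close>.

  Together, \<open>G \<bullet> m\<^sub>\<delta> \<rightarrow> 0\<close> for the scaled tent moments \<open>m\<^sub>\<delta>\<close> (\<open>gradient_inner_moment_tendsto_0\<close>, which holds
  on every convex open set). For \<open>n \<ge> 2\<close> the moments converge to \<open>\<nu>(x\<^sub>0)\<close>, which gives the claim. For \<open>n = 1\<close>
  no convergence is assumed, but the tents decrease away from the boundary, so \<open>m\<^sub>\<delta>\<close> is bounded
  away from zero by the lower bound on the kernel (\<open>one_dim_moment_bound\<close>), and \<open>G = 0\<close>.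
\<close>

section \<open>Integrability of the scaled weight\<close>

lemma nn_integral_affine:
  fixes f :: "'a::euclidean_space \<Rightarrow> ennreal" and c :: real
  assumes [measurable]: "f \<in> borel_measurable borel" and c: "c \<noteq> 0"
  shows "(\<integral>\<^sup>+x. f x \<partial>lborel) = ennreal (\<bar>c\<bar> ^ DIM('a)) * (\<integral>\<^sup>+x. f (t + c *\<^sub>R x) \<partial>lborel)"
  by (subst lborel_affine[OF c, of t])
     (simp add: nn_integral_density nn_integral_distr nn_integral_cmult)

text \<open>
  The function is dominated by the sum over \<open>j\<close> of \<open>c j\<close> times the indicator of the ball of radius \<open>r j\<close>.
  With geometric sequences this replaces integration in polar
  coordinates.
\<close>

lemma nn_integral_finite_by_ball_cover:
  fixes f :: "'a::euclidean_space \<Rightarrow> ennreal" and c r :: "nat \<Rightarrow> real"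
  assumes c: "\<And>j. 0 \<le> c j" and r: "\<And>j. 0 \<le> r j"
    and sum: "summable (\<lambda>j. c j * r j ^ DIM('a))"
    and cover: "\<And>z. f z \<noteq> 0 \<Longrightarrow> \<exists>j. norm z < r j \<and> f z \<le> ennreal (c j)"
  shows "(\<integral>\<^sup>+z. f z \<partial>lborel) < \<infinity>"
proof -
  let ?V = "unit_ball_vol (DIM('a))"
  have [measurable]: "ball (0::'a) (r j) \<in> sets borel" for j by simp
  have le: "f z \<le> (\<Sum>j. ennreal (c j) * indicator (ball 0 (r j)) z)" for z
  proof (cases "f z = 0")
    case False
    then obtain j where j: "norm z < r j" "f z \<le> ennreal (c j)"
      using cover by blast
    have "ennreal (c j) * indicator (ball 0 (r j)) z
        = (\<Sum>i\<in>{j}. ennreal (c i) * indicator (ball 0 (r i)) z)"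
      by (simp del: sum_mult_indicator)
    also have "\<dots> \<le> (\<Sum>j. ennreal (c j) * indicator (ball 0 (r j)) z)"
      by (intro sum_le_suminf) auto
    finally show ?thesis using j by (auto simp: indicator_def)
  qed simp
  have "(\<integral>\<^sup>+z. f z \<partial>lborel) \<le> (\<integral>\<^sup>+z. (\<Sum>j. ennreal (c j) * indicator (ball (0::'a) (r j)) z) \<partial>lborel)"
    by (rule nn_integral_mono) (rule le)
  also have "\<dots> = (\<Sum>j. ennreal (c j) * emeasure lborel (ball (0::'a) (r j)))"
    by (subst nn_integral_suminf) (simp_all add: nn_integral_cmult_indicator)
  also have "\<dots> = (\<Sum>j. ennreal (?V * (c j * r j ^ DIM('a))))"
    using c r by (intro suminf_cong) (simp add: emeasure_ball ennreal_mult' [symmetric] mult_ac)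
  also have "\<dots> = ennreal (\<Sum>j. ?V * (c j * r j ^ DIM('a)))"
    using c r sum by (intro suminf_ennreal2 summable_mult) auto
  also have "\<dots> < \<infinity>" by simp
  finally show ?thesis .
qed

text \<open>
  The factor \<open>min (\<bar>z\<bar>/\<delta>) 1\<close> bounds the increment over \<open>z\<close> of a tent of radius \<open>\<delta>\<close>, and
  \<open>\<bar>z\<bar>\<^bsup>1-n-\<alpha>\<^esup>\<close> is the size of the kernel times that of the increment of a Lipschitz function.
\<close>

definition weight :: "real \<Rightarrow> real \<Rightarrow> 'a::euclidean_space \<Rightarrow> real" where
  "weight \<alpha> \<delta> z = min (norm z / \<delta>) 1 * norm z powr (1 - real DIM('a) - \<alpha>)"

lemma weight_nonneg: "0 < \<delta> \<Longrightarrow> 0 \<le> weight \<alpha> \<delta> z"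
  by (simp add: weight_def)

lemma weight_measurable[measurable]: "weight \<alpha> \<delta> \<in> borel_measurable borel"
  unfolding weight_def by measurable

lemma weight_scale:
  fixes z :: "'a::euclidean_space"
  assumes "0 < \<delta>"
  shows "weight \<alpha> \<delta> (\<delta> *\<^sub>R z) = \<delta> powr (1 - real DIM('a) - \<alpha>) * weight \<alpha> 1 z"
  using assms by (simp add: weight_def powr_mult)

lemma weight_of_le_norm:
  fixes z :: "'a::euclidean_space"
  assumes "0 < r" "r \<le> norm z"
  shows "weight \<alpha> r z = norm z powr (1 - real DIM('a) - \<alpha>)"
  using assms by (simp add: weight_def min_absorb2)

text \<open>
  Cover the punctured unit ball by dyadic shells: on the shell \<open>2\<^bsup>-j-1\<^esup> \<le> \<bar>z\<bar> < 2\<^bsup>-j\<^esup>\<close> the integrand is at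
  most \<open>2\<^bsup>s(j+1)\<^esup>\<close>, and the volume is at most a multiple of \<open>2\<^bsup>-nj\<^esup>\<close>.
\<close>

lemma nn_integral_norm_powr_near_zero:
  fixes s :: real
  assumes "0 \<le> s" "s < real DIM('a::euclidean_space)"
  shows "(\<integral>\<^sup>+z. ennreal (norm (z::'a) powr (- s) * indicator (ball 0 1 - {0}) z) \<partial>lborel) < \<infinity>"
proof (rule nn_integral_finite_by_ball_cover[where c = "\<lambda>j. 2 powr (s * (real j + 1))" and r = "\<lambda>j. (1/2) ^ j"])
  let ?n = "real DIM('a)"
  have "2 powr (s * (real j + 1)) * ((1/2) ^ j) ^ DIM('a) = 2 powr s * (2 powr (s - ?n)) ^ j" for j
  proof -
    have "((1/2::real) ^ j) ^ DIM('a) = 2 powr (- (?n * real j))"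
      by (simp add: powr_realpow[symmetric] powr_powr powr_minus power_one_over divide_simps mult.commute)
    then show ?thesis
      by (simp add: powr_realpow[symmetric] powr_powr powr_add[symmetric] algebra_simps)
  qed
  moreover have "2 powr (s - ?n) < (1::real)"
    using assms powr_less_cancel_iff[of 2 "s - ?n" 0] by simp
  ultimately show "summable (\<lambda>j. 2 powr (s * (real j + 1)) * ((1/2) ^ j) ^ DIM('a))"
    by (simp add: summable_mult summable_geometric)
next
  fix z :: 'a
  assume "ennreal (norm z powr - s * indicator (ball 0 1 - {0}) z) \<noteq> 0"
  then have z: "z \<noteq> 0" "norm z < 1" by (auto simp: indicator_def split: if_splits)
  \<comment> \<open>the number of the shell that contains \<open>z\<close>\<close>
  define j where "j = (LEAST j. (1/2)^(Suc j) \<le> norm z)"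
  have ex: "\<exists>j. (1/2)^(Suc j) \<le> norm z"
  proof -
    obtain j where "(1/2)^j < norm z"
      using real_arch_pow_inv[of "norm z" "1/2"] z by auto
    moreover have "(1/2::real)^Suc j \<le> (1/2)^j" by simp
    ultimately show ?thesis by (intro exI[of _ j]) linarith
  qed
  have 1: "(1/2)^(Suc j) \<le> norm z"
    unfolding j_def by (rule LeastI_ex[OF ex])
  have 2: "norm z < (1/2)^j"
  proof (cases j)
    case (Suc i)
    then have "\<not> (1/2)^(Suc i) \<le> norm z"
      using not_less_Least[of i "\<lambda>j. (1/2)^(Suc j) \<le> norm z"] by (simp add: j_def)
    then show ?thesis using Suc by simp
  qed (use z in simp)
  have "norm z powr (- s) \<le> ((1/2)^(Suc j)) powr (- s)"
    using 1 assms z by (intro powr_mono2') auto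
  also have "\<dots> = 2 powr (s * (real j + 1))"
    by (simp add: powr_realpow[symmetric] powr_powr powr_divide powr_minus power_one_over divide_simps
         powr_add[symmetric] powr_mult algebra_simps del: power_Suc)
  finally show "\<exists>j. norm z < (1/2)^j \<and> ennreal (norm z powr - s * indicator (ball 0 1 - {0}) z)
      \<le> ennreal (2 powr (s * (real j + 1)))"
    using 2 z by (intro exI[of _ j]) (auto simp: indicator_def intro!: ennreal_leI)
qed auto

text \<open>
  The same argument with the shells \<open>2\<^sup>j \<le> \<bar>z\<bar> < 2\<^bsup>j+1\<^esup>\<close>.
\<close>

lemma nn_integral_norm_powr_at_infinity:
  fixes s :: real
  assumes "real DIM('a::euclidean_space) < s"
  shows "(\<integral>\<^sup>+z. ennreal (norm (z::'a) powr (- s) * indicator (- ball 0 1) z) \<partial>lborel) < \<infinity>"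
proof (rule nn_integral_finite_by_ball_cover[where c = "\<lambda>j. 2 powr (- s * real j)" and r = "\<lambda>j. 2 * 2 ^ j"])
  let ?n = "real DIM('a)"
  have "2 powr (- s * real j) * (2 * 2 ^ j) ^ DIM('a) = 2 ^ DIM('a) * (2 powr (?n - s)) ^ j" for j
  proof -
    have "((2::real) ^ j) ^ DIM('a) = 2 powr (?n * real j)"
      by (simp add: powr_realpow[symmetric] powr_powr mult.commute)
    then show ?thesis
      by (simp add: powr_realpow[symmetric] powr_powr powr_add[symmetric] power_mult_distrib algebra_simps)
  qed
  moreover have "2 powr (?n - s) < (1::real)"
    using assms powr_less_cancel_iff[of 2 "?n - s" 0] by simp
  ultimately show "summable (\<lambda>j. 2 powr (- s * real j) * (2 * 2 ^ j) ^ DIM('a))"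
    by (simp only:) (simp add: summable_mult summable_geometric)
next
  fix z :: 'a
  assume "ennreal (norm z powr - s * indicator (- ball 0 1) z) \<noteq> 0"
  then have z: "1 \<le> norm z" by (auto simp: indicator_def split: if_splits)
  define j where "j = (LEAST j. norm z < 2^(Suc j))"
  have ex: "\<exists>j. norm z < 2^(Suc j)"
  proof -
    obtain j where "norm z < 2^j"
      using real_arch_pow[of 2 "norm z"] by auto
    moreover have "(2::real)^j \<le> 2^Suc j" by simp
    ultimately show ?thesis by (intro exI[of _ j]) linarith
  qed
  have 1: "norm z < 2^(Suc j)"
    unfolding j_def by (rule LeastI_ex[OF ex])
  have 2: "2^j \<le> norm z"
  proof (cases j)
    case (Suc i)
    then have "\<not> norm z < 2^(Suc i)"
      using not_less_Least[of i "\<lambda>j. norm z < 2^(Suc j)"] by (simp add: j_def)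
    then show ?thesis using Suc by simp
  qed (use z in simp)
  have "norm z powr (- s) \<le> (2^j) powr (- s)"
    using 2 assms z by (intro powr_mono2') auto
  also have "\<dots> = 2 powr (- s * real j)"
    by (simp add: powr_realpow[symmetric] powr_powr mult.commute)
  finally show "\<exists>j. norm z < 2 * 2^j \<and> ennreal (norm z powr - s * indicator (- ball 0 1) z)
      \<le> ennreal (2 powr (- s * real j))"
    using 1 z by (intro exI[of _ j]) (auto simp: indicator_def intro!: ennreal_leI)
qed auto

text \<open>
  Near zero the weight is \<open>\<bar>z\<bar>\<^bsup>2-n-\<alpha>\<^esup>\<close>, where \<open>\<alpha> < 2\<close> is needed; away from zero it is \<open>\<bar>z\<bar>\<^bsup>1-n-\<alpha>\<^esup>\<close>,
  where \<open>\<alpha> > 1\<close> is needed.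
\<close>

lemma nn_integral_weight_finite:
  fixes \<alpha> :: real
  assumes "1 < \<alpha>" "\<alpha> < 2"
  shows "(\<integral>\<^sup>+z. ennreal (weight \<alpha> 1 (z::'a::euclidean_space)) \<partial>lborel) < \<infinity>"
proof -
  let ?n = "real DIM('a)"
  define f where "f = (\<lambda>z::'a. ennreal (norm z powr (- (?n + \<alpha> - 2)) * indicator (ball 0 1 - {0}) z))"
  define g where "g = (\<lambda>z::'a. ennreal (norm z powr (- (?n + \<alpha> - 1)) * indicator (- ball 0 1) z))"
  have [measurable]: "ball (0::'a) 1 \<in> sets borel" by simp
  have [measurable]: "f \<in> borel_measurable borel" "g \<in> borel_measurable borel"
    unfolding f_def g_def by measurable
  have "1 \<le> ?n" using DIM_positive[where 'a='a] by linarith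
  then have "(\<integral>\<^sup>+z. f z \<partial>lborel) < \<infinity>" "(\<integral>\<^sup>+z. g z \<partial>lborel) < \<infinity>"
    unfolding f_def g_def using assms
    by (intro nn_integral_norm_powr_near_zero nn_integral_norm_powr_at_infinity; linarith)+
  moreover have "ennreal (weight \<alpha> 1 z) \<le> f z + g z" for z
  proof (cases "z = 0 \<or> 1 \<le> norm z")
    case True
    then show ?thesis
      by (auto simp: weight_def f_def g_def algebra_simps)
  next
    case False
    then have "norm z * norm z powr (1 - ?n - \<alpha>) = norm z powr (- (?n + \<alpha> - 2))"
      using powr_add[of "norm z" 1 "1 - ?n - \<alpha>"] by (simp add: algebra_simps)
    with False show ?thesis
      by (simp add: weight_def f_def g_def)
  qed
  then have "(\<integral>\<^sup>+z. ennreal (weight \<alpha> 1 (z::'a)) \<partial>lborel) \<le> (\<integral>\<^sup>+z. f z + g z \<partial>lborel)"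
    by (intro nn_integral_mono)
  ultimately show ?thesis
    by (auto simp: nn_integral_add intro: le_less_trans)
qed

lemma nn_integral_weight:
  fixes \<alpha> \<delta> :: real
  assumes "0 < \<delta>"
  shows "(\<integral>\<^sup>+z. ennreal (weight \<alpha> \<delta> (z::'a::euclidean_space)) \<partial>lborel)
    = ennreal (\<delta> powr (1 - \<alpha>)) * (\<integral>\<^sup>+z. ennreal (weight \<alpha> 1 (z::'a)) \<partial>lborel)"
proof -
  have "\<delta> ^ DIM('a) * \<delta> powr (1 - real DIM('a) - \<alpha>) = \<delta> powr (1 - \<alpha>)"
    using assms by (simp add: powr_realpow[symmetric] powr_add[symmetric])
  moreover have "(\<integral>\<^sup>+z. ennreal (weight \<alpha> \<delta> (z::'a)) \<partial>lborel)
    = ennreal (\<delta> ^ DIM('a)) * (ennreal (\<delta> powr (1 - real DIM('a) - \<alpha>)) *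
        (\<integral>\<^sup>+z. ennreal (weight \<alpha> 1 (z::'a)) \<partial>lborel))"
    using assms
    by (subst nn_integral_affine[where c=\<delta> and t=0])
       (simp_all add: weight_scale ennreal_mult' nn_integral_cmult)
  ultimately show ?thesis
    using assms by (simp add: mult.assoc[symmetric] ennreal_mult'[symmetric])
qed

lemma nn_integral_weight_le:
  fixes \<alpha> :: real
  assumes "1 < \<alpha>" "\<alpha> < 2"
  obtains C where "0 \<le> C"
    "\<And>\<delta>. 0 < \<delta> \<Longrightarrow> (\<integral>\<^sup>+z. ennreal (weight \<alpha> \<delta> (z::'a::euclidean_space)) \<partial>lborel) \<le> ennreal (C * \<delta> powr (1 - \<alpha>))"
proof (rule that)
  let ?C = "enn2real (\<integral>\<^sup>+z. ennreal (weight \<alpha> 1 (z::'a)) \<partial>lborel)"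
  show "0 \<le> ?C" by simp
  have "ennreal ?C = (\<integral>\<^sup>+z. ennreal (weight \<alpha> 1 (z::'a)) \<partial>lborel)"
    using nn_integral_weight_finite[OF assms, where 'a='a] by simp
  then show "(\<integral>\<^sup>+z. ennreal (weight \<alpha> \<delta> (z::'a)) \<partial>lborel) \<le> ennreal (?C * \<delta> powr (1 - \<alpha>))"
    if "0 < \<delta>" for \<delta>
    using nn_integral_weight[OF that, of \<alpha>, where 'a='a] by (simp add: ennreal_mult mult.commute)
qed

text \<open>
  A sum of two indicators, and not the indicator of the union, because then the integral against a
  function of \<open>x - y\<close> splits into two products.
\<close>

definition near :: "'a::euclidean_space \<Rightarrow> real \<Rightarrow> 'a \<Rightarrow> 'a \<Rightarrow> real" where
  "near x\<^sub>0 \<delta> x y = indicator (ball x\<^sub>0 \<delta>) x + indicator (ball x\<^sub>0 \<delta>) y"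

lemma near_measurable[measurable]: "(\<lambda>(x, y). near x\<^sub>0 \<delta> x y) \<in> borel_measurable (borel \<Otimes>\<^sub>M borel)"
proof -
  have [measurable]: "ball x\<^sub>0 \<delta> \<in> sets borel" by simp
  show ?thesis unfolding near_def by measurable
qed

lemma near_nonneg: "0 \<le> near x\<^sub>0 \<delta> x y"
  by (simp add: near_def)

lemma nn_integral_near_convolution:
  fixes h :: "'a::euclidean_space \<Rightarrow> real"
  assumes [measurable]: "h \<in> borel_measurable borel" and h: "\<And>z. 0 \<le> h z" and \<delta>: "0 \<le> \<delta>"
  shows "(\<integral>\<^sup>+y. \<integral>\<^sup>+x. ennreal (near x\<^sub>0 \<delta> x y * h (x - y)) \<partial>lborel \<partial>lborel)
    = 2 * ennreal (unit_ball_vol (DIM('a)) * \<delta> ^ DIM('a)) * (\<integral>\<^sup>+z. ennreal (h z) \<partial>lborel)"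
proof -
  let ?B = "ball x\<^sub>0 \<delta>"
  have [measurable]: "?B \<in> sets borel" by simp
  let ?I = "\<integral>\<^sup>+z. ennreal (h z) \<partial>lborel"
  have x: "(\<integral>\<^sup>+x. ennreal (h (x - y)) \<partial>lborel) = ?I" for y
    using nn_integral_affine[of "\<lambda>x. ennreal (h (x - y))" 1 y] by simp
  have y: "(\<integral>\<^sup>+y. ennreal (h (x - y)) \<partial>lborel) = ?I" for x
    using nn_integral_affine[of "\<lambda>y. ennreal (h (x - y))" "-1" x] by simp
  have "(\<integral>\<^sup>+y. \<integral>\<^sup>+x. ennreal (near x\<^sub>0 \<delta> x y * h (x - y)) \<partial>lborel \<partial>lborel)
     = (\<integral>\<^sup>+y. \<integral>\<^sup>+x. indicator ?B x * ennreal (h (x - y)) + indicator ?B y * ennreal (h (x - y)) \<partial>lborel \<partial>lborel)"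
    using h by (intro nn_integral_cong) (auto simp: near_def indicator_def ennreal_mult' distrib_right simp flip: ennreal_plus)
  also have "\<dots> = (\<integral>\<^sup>+y. \<integral>\<^sup>+x. indicator ?B x * ennreal (h (x - y)) \<partial>lborel \<partial>lborel)
      + (\<integral>\<^sup>+y. \<integral>\<^sup>+x. indicator ?B y * ennreal (h (x - y)) \<partial>lborel \<partial>lborel)"
    by (simp add: nn_integral_add)
  also have "(\<integral>\<^sup>+y. \<integral>\<^sup>+x. indicator ?B x * ennreal (h (x - y)) \<partial>lborel \<partial>lborel)
      = (\<integral>\<^sup>+x. \<integral>\<^sup>+y. indicator ?B x * ennreal (h (x - y)) \<partial>lborel \<partial>lborel)"
    by (rule lborel_pair.Fubini') simp
  also have "\<dots> = emeasure lborel ?B * ?I"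
    by (simp add: nn_integral_cmult nn_integral_multc y)
  also have "(\<integral>\<^sup>+y. \<integral>\<^sup>+x. indicator ?B y * ennreal (h (x - y)) \<partial>lborel \<partial>lborel) = emeasure lborel ?B * ?I"
    by (simp add: nn_integral_cmult nn_integral_multc x)
  finally show ?thesis
    using \<delta> by (simp add: emeasure_ball mult_2 distrib_right)
qed

section \<open>Iterated integrals over a domain\<close>

text \<open>
  The energy form and the tent moments are iterated Lebesgue integrals over \<open>\<Omega>\<close>. For Borel measurable integrands they
  become one integral over a product measure, where linearity and
  domination are available without a discussion of the inner integrals.
\<close>

lemma integral_lebesgue_on_iterated:
  fixes F :: "'a::euclidean_space \<Rightarrow> 'a \<Rightarrow> 'b::{banach,second_countable_topology}"
  assumes \<Omega>: "\<Omega> \<in> sets borel"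
    and int: "integrable (lborel \<Otimes>\<^sub>M lborel) (\<lambda>(x, y). indicator (\<Omega> \<times> \<Omega>) (x, y) *\<^sub>R F x y)"
  shows "(LINT y|lebesgue_on \<Omega>. LINT x|lebesgue_on \<Omega>. F x y)
    = (LINT (x, y)|(lborel \<Otimes>\<^sub>M lborel). indicator (\<Omega> \<times> \<Omega>) (x, y) *\<^sub>R F x y)"
proof -
  define G where "G = (\<lambda>x y. indicator (\<Omega> \<times> \<Omega>) (x, y) *\<^sub>R F x y)"
  have int: "integrable (lborel \<Otimes>\<^sub>M lborel) (\<lambda>(x, y). G x y)"
    using int by (simp add: G_def)
  then have [measurable]: "(\<lambda>(x, y). G x y) \<in> borel_measurable (lborel \<Otimes>\<^sub>M lborel)"
    by (rule borel_measurable_integrable)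
  have \<Omega>': "\<Omega> \<inter> space lebesgue \<in> sets lebesgue"
    using \<Omega> by simp
  have inner: "indicator \<Omega> y *\<^sub>R (LINT x|lebesgue_on \<Omega>. F x y) = (LINT x|lborel. G x y)" for y
  proof -
    have "indicator \<Omega> y *\<^sub>R (LINT x|lebesgue_on \<Omega>. F x y)
        = indicator \<Omega> y *\<^sub>R (LINT x|lebesgue. indicator \<Omega> x *\<^sub>R F x y)"
      by (simp only: integral_restrict_space[OF \<Omega>'])
    also have "\<dots> = (LINT x|lebesgue. G x y)"
      by (auto simp: G_def indicator_def intro!: Bochner_Integration.integral_cong)
    also have "\<dots> = (LINT x|lborel. G x y)"
      by (rule integral_completion) measurable
    finally show ?thesis .
  qed
  have "(LINT y|lebesgue_on \<Omega>. LINT x|lebesgue_on \<Omega>. F x y) = (LINT y|lebesgue. LINT x|lborel. G x y)"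
    by (subst integral_restrict_space[OF \<Omega>']) (simp only: inner)
  also have "\<dots> = (LINT y|lborel. LINT x|lborel. G x y)"
    by (rule integral_completion) measurable
  also have "\<dots> = (LINT (x, y)|(lborel \<Otimes>\<^sub>M lborel). G x y)"
    by (rule lborel_pair.integral_snd[OF int])
  finally show ?thesis by (simp only: G_def)
qed

lemma nn_integral_lebesgue_on_le:
  fixes f :: "'a::euclidean_space \<Rightarrow> ennreal"
  assumes "\<Omega> \<in> sets borel" and "\<And>x. x \<in> \<Omega> \<Longrightarrow> f x \<le> h x"
  shows "(\<integral>\<^sup>+x. f x \<partial>lebesgue_on \<Omega>) \<le> (\<integral>\<^sup>+x. h x \<partial>lborel)"
proof -
  have "(\<integral>\<^sup>+x. f x \<partial>lebesgue_on \<Omega>) = (\<integral>\<^sup>+x. f x * indicator \<Omega> x \<partial>lborel)"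
    using assms(1) by (simp add: nn_integral_restrict_space nn_integral_completion)
  also have "\<dots> \<le> (\<integral>\<^sup>+x. h x \<partial>lborel)"
    using assms(2) by (intro nn_integral_mono) (auto simp: indicator_def)
  finally show ?thesis .
qed

section \<open>Increments of tent functions\<close>

lemma tent_eq_max: "0 < \<delta> \<Longrightarrow> tent x\<^sub>0 \<delta> x = max 0 (1 - norm (x - x\<^sub>0) / \<delta>)"
  by (auto simp: tent_def max_def field_simps)

lemma tent_bounds: "0 < \<delta> \<Longrightarrow> 0 \<le> tent x\<^sub>0 \<delta> x \<and> tent x\<^sub>0 \<delta> x \<le> indicator (ball x\<^sub>0 \<delta>) x"
  by (auto simp: tent_def indicator_def dist_norm norm_minus_commute field_simps)

lemma continuous_on_tent: "0 < \<delta> \<Longrightarrow> continuous_on A (tent x\<^sub>0 \<delta>)"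
  by (subst continuous_on_cong[OF refl tent_eq_max]) (auto intro!: continuous_intros)

text \<open>
  A tent is Lipschitz with constant \<open>1/\<delta>\<close> and has values in \<open>[0, 1]\<close>; the increment vanishes if both points are
  outside the ball.
\<close>

lemma abs_tent_diff_le:
  assumes \<delta>: "0 < \<delta>"
  shows "\<bar>tent x\<^sub>0 \<delta> x - tent x\<^sub>0 \<delta> y\<bar> \<le> near x\<^sub>0 \<delta> x y * min (norm (x - y) / \<delta>) 1"
proof (cases "x \<in> ball x\<^sub>0 \<delta> \<or> y \<in> ball x\<^sub>0 \<delta>")
  case True
  have "\<bar>tent x\<^sub>0 \<delta> x - tent x\<^sub>0 \<delta> y\<bar> \<le> \<bar>norm (y - x\<^sub>0) / \<delta> - norm (x - x\<^sub>0) / \<delta>\<bar>"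
    using \<delta> by (simp add: tent_eq_max)
  also have "\<dots> = \<bar>norm (x - x\<^sub>0) - norm (y - x\<^sub>0)\<bar> / \<delta>"
    using \<delta> by (simp add: diff_divide_distrib[symmetric] abs_minus_commute)
  also have "\<dots> \<le> norm (x - y) / \<delta>"
    using norm_triangle_ineq3[of "x - x\<^sub>0" "y - x\<^sub>0"] \<delta> by (simp add: divide_right_mono)
  finally have 1: "\<bar>tent x\<^sub>0 \<delta> x - tent x\<^sub>0 \<delta> y\<bar> \<le> norm (x - y) / \<delta>" .
  have "tent x\<^sub>0 \<delta> z \<le> 1" "0 \<le> tent x\<^sub>0 \<delta> z" for z
    using \<delta> by (auto simp: tent_def field_simps)
  then have "\<bar>tent x\<^sub>0 \<delta> x - tent x\<^sub>0 \<delta> y\<bar> \<le> 1"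
    by (smt (verit))
  with 1 have 2: "\<bar>tent x\<^sub>0 \<delta> x - tent x\<^sub>0 \<delta> y\<bar> \<le> min (norm (x - y) / \<delta>) 1"
    by simp
  have "1 \<le> near x\<^sub>0 \<delta> x y"
    using True by (auto simp: near_def)
  then have "1 * min (norm (x - y) / \<delta>) 1 \<le> near x\<^sub>0 \<delta> x y * min (norm (x - y) / \<delta>) 1"
    using \<delta> by (intro mult_right_mono) auto
  with 2 show ?thesis
    by linarith
next
  case False
  then show ?thesis
    by (simp add: tent_def near_def dist_norm norm_minus_commute)
qed

lemma tent_diff_weight:
  fixes x y :: "real^'n"
  assumes \<delta>: "0 < \<delta>"
  shows "\<bar>tent x\<^sub>0 \<delta> x - tent x\<^sub>0 \<delta> y\<bar> * norm (x - y) powr (1 - real CARD('n) - \<alpha>)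
    \<le> near x\<^sub>0 \<delta> x y * weight \<alpha> \<delta> (x - y)"
  using mult_right_mono[OF abs_tent_diff_le[OF \<delta>, of x\<^sub>0 x y], of "norm (x - y) powr (1 - real CARD('n) - \<alpha>)"]
  by (simp add: weight_def mult.assoc)

text \<open>
  For points at distance at least \<open>r\<close> the weight with the larger radius \<open>r\<close> suffices. Its integral
  does not depend on \<open>\<delta>\<close>, so that such pairs of points are negligible after scaling.
\<close>

lemma tent_diff_weight_far:
  fixes x y :: "real^'n"
  assumes \<delta>: "0 < \<delta>" and r: "0 < r" "r \<le> norm (x - y)"
  shows "\<bar>tent x\<^sub>0 \<delta> x - tent x\<^sub>0 \<delta> y\<bar> * norm (x - y) powr (1 - real CARD('n) - \<alpha>)
    \<le> near x\<^sub>0 \<delta> x y * weight \<alpha> r (x - y)"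
proof -
  have "near x\<^sub>0 \<delta> x y * min (norm (x - y) / \<delta>) 1 \<le> near x\<^sub>0 \<delta> x y * 1"
    by (intro mult_left_mono near_nonneg) simp
  with abs_tent_diff_le[OF \<delta>, of x\<^sub>0 x y] have "\<bar>tent x\<^sub>0 \<delta> x - tent x\<^sub>0 \<delta> y\<bar> \<le> near x\<^sub>0 \<delta> x y"
    by simp
  from mult_right_mono[OF this, of "norm (x - y) powr (1 - real CARD('n) - \<alpha>)"] show ?thesis
    by (simp add: weight_of_le_norm[OF r])
qed

section \<open>Forms with a singular kernel\<close>

text \<open>
  The part of admissibility that makes the integrals measurable and convergent.
\<close>

definition singular_kernel ::
    "real \<Rightarrow> real \<Rightarrow> (real^'n \<Rightarrow> real^'n \<Rightarrow> real^'n \<Rightarrow> real) \<Rightarrow> bool" where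
  "singular_kernel \<alpha> K k \<longleftrightarrow> 0 \<le> K \<and>
     continuous_on {(x, y). x \<noteq> y} (\<lambda>(x, y). k x y (x - y)) \<and>
     (\<forall>x y. x \<noteq> y \<longrightarrow> \<bar>k x y (x - y)\<bar> \<le> K * norm (x - y) powr (- real CARD('n) - \<alpha>))"

text \<open>
  Energy forms are the case \<open>a x y = u x - u y\<close>, tent moments the case \<open>a x y = x - y\<close>. The values of \<open>a\<close>
  are vectors so that both are covered.
\<close>

definition kernel_form ::
    "(real^'n) set \<Rightarrow> (real^'n \<Rightarrow> real^'n \<Rightarrow> real^'n \<Rightarrow> real) \<Rightarrow> (real^'n \<Rightarrow> real) \<Rightarrow>
      (real^'n \<Rightarrow> real^'n \<Rightarrow> 'b::euclidean_space) \<Rightarrow> 'b" where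
  "kernel_form \<Omega> k \<phi> a =
     (LINT y|lebesgue_on \<Omega>. LINT x|lebesgue_on \<Omega>. ((\<phi> x - \<phi> y) * k x y (x - y)) *\<^sub>R a x y)"

definition kernel_integrand ::
    "(real^'n) set \<Rightarrow> (real^'n \<Rightarrow> real^'n \<Rightarrow> real^'n \<Rightarrow> real) \<Rightarrow> (real^'n \<Rightarrow> real) \<Rightarrow>
      (real^'n \<Rightarrow> real^'n \<Rightarrow> 'b::euclidean_space) \<Rightarrow> (real^'n) \<times> (real^'n) \<Rightarrow> 'b" where
  "kernel_integrand \<Omega> k \<phi> a =
     (\<lambda>(x, y). indicator (\<Omega> \<times> \<Omega>) (x, y) *\<^sub>R (((\<phi> x - \<phi> y) * k x y (x - y)) *\<^sub>R a x y))"

lemma kernel_form_eq: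
  assumes "open \<Omega>" "integrable (lborel \<Otimes>\<^sub>M lborel) (kernel_integrand \<Omega> k \<phi> a)"
  shows "kernel_form \<Omega> k \<phi> a = (LINT z|(lborel \<Otimes>\<^sub>M lborel). kernel_integrand \<Omega> k \<phi> a z)"
  using assms unfolding kernel_form_def kernel_integrand_def
  by (intro integral_lebesgue_on_iterated) auto

text \<open>
  The integrand is continuous on the open set of pairs of distinct points of \<open>\<Omega>\<close>. On the diagonal, where nothing is known
  about the kernel, the increment of \<open>\<phi>\<close> vanishes.
\<close>

lemma kernel_integrand_measurable:
  fixes a :: "real^'n \<Rightarrow> real^'n \<Rightarrow> 'b::euclidean_space"
  assumes "open \<Omega>" and k: "singular_kernel \<alpha> K k" and \<phi>: "continuous_on \<Omega> \<phi>"
    and a: "continuous_on (\<Omega> \<times> \<Omega>) (\<lambda>(x, y). a x y)"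
  shows "kernel_integrand \<Omega> k \<phi> a \<in> borel_measurable (lborel \<Otimes>\<^sub>M lborel)"
proof -
  let ?D = "{(x, y). x \<in> \<Omega> \<and> y \<in> \<Omega> \<and> x \<noteq> y}"
  have D_eq: "?D = (\<Omega> \<times> \<Omega>) \<inter> - {z. fst z = snd z}" by auto
  have "open ?D"
    unfolding D_eq using \<open>open \<Omega>\<close>
    by (intro open_Int open_Times open_Compl closed_Collect_eq continuous_intros)
  moreover have "continuous_on ?D (\<lambda>(x, y). ((\<phi> x - \<phi> y) * k x y (x - y)) *\<^sub>R a x y)"
  proof -
    have "continuous_on ?D (\<lambda>z. case z of (x, y) \<Rightarrow> k x y (x - y))"
      using k unfolding singular_kernel_def by (auto elim: continuous_on_subset)
    moreover have "continuous_on ?D (\<lambda>z. case z of (x, y) \<Rightarrow> a x y)"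
      by (rule continuous_on_subset[OF a]) auto
    moreover have "continuous_on ?D (\<lambda>z. \<phi> (fst z))" "continuous_on ?D (\<lambda>z. \<phi> (snd z))"
      by (auto intro!: continuous_on_compose2[OF \<phi>] continuous_intros)
    ultimately have "continuous_on ?D (\<lambda>z. ((\<phi> (fst z) - \<phi> (snd z)) *
        (case z of (x, y) \<Rightarrow> k x y (x - y))) *\<^sub>R (case z of (x, y) \<Rightarrow> a x y))"
      by (intro continuous_intros)
    then show ?thesis by (simp add: case_prod_unfold)
  qed
  ultimately have "(\<lambda>z. indicator ?D z *\<^sub>R (case z of (x, y) \<Rightarrow> ((\<phi> x - \<phi> y) * k x y (x - y)) *\<^sub>R a x y))
      \<in> borel_measurable borel"
    by (intro borel_measurable_continuous_on_indicator) auto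
  also have "(\<lambda>z. indicator ?D z *\<^sub>R (case z of (x, y) \<Rightarrow> ((\<phi> x - \<phi> y) * k x y (x - y)) *\<^sub>R a x y))
      = kernel_integrand \<Omega> k \<phi> a"
    by (auto simp: kernel_integrand_def indicator_def fun_eq_iff)
  finally show ?thesis
    by (simp add: lborel_prod)
qed

text \<open>
  All convergence statements and all estimates of forms rest on this bound: if the integrand is controlled by a function \<open>h\<close> of
  \<open>x - y\<close>, localised to pairs with a point in the ball of radius \<open>\<delta>\<close>, then Tonelli's theorem gives
  the volume of that ball times the integral of \<open>h\<close>, once for each of the two points.
\<close>

lemma kernel_form_tent_bound:
  fixes a :: "real^'n \<Rightarrow> real^'n \<Rightarrow> 'b::euclidean_space"
  assumes "open \<Omega>" and k: "singular_kernel \<alpha> K k" and \<delta>: "0 < \<delta>"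
    and a: "continuous_on (\<Omega> \<times> \<Omega>) (\<lambda>(x, y). a x y)"
    and h: "h \<in> borel_measurable borel" "\<And>z. 0 \<le> h z" "(\<integral>\<^sup>+z. ennreal (h z) \<partial>lborel) \<le> ennreal c" "0 \<le> c"
    and le: "\<And>x y. x \<in> \<Omega> \<Longrightarrow> y \<in> \<Omega> \<Longrightarrow> x \<noteq> y \<Longrightarrow>
      \<bar>tent x\<^sub>0 \<delta> x - tent x\<^sub>0 \<delta> y\<bar> * norm (x - y) powr (- real CARD('n) - \<alpha>) * norm (a x y)
        \<le> near x\<^sub>0 \<delta> x y * h (x - y)"
  shows "integrable (lborel \<Otimes>\<^sub>M lborel) (kernel_integrand \<Omega> k (tent x\<^sub>0 \<delta>) a)" (is ?I)
    and "norm (kernel_form \<Omega> k (tent x\<^sub>0 \<delta>) a) \<le> 2 * K * unit_ball_vol (real CARD('n)) * \<delta> ^ CARD('n) * c"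
proof -
  let ?F = "kernel_integrand \<Omega> k (tent x\<^sub>0 \<delta>) a"
  let ?V = "unit_ball_vol (real CARD('n))"
  have K: "0 \<le> K" using k by (simp add: singular_kernel_def)
  note [measurable] = h(1)
  have meas: "?F \<in> borel_measurable (lborel \<Otimes>\<^sub>M lborel)"
    by (rule kernel_integrand_measurable[OF \<open>open \<Omega>\<close> k continuous_on_tent[OF \<delta>] a])
  have pt: "norm (?F (x, y)) \<le> K * (near x\<^sub>0 \<delta> x y * h (x - y))" for x y
  proof (cases "x \<in> \<Omega> \<and> y \<in> \<Omega> \<and> x \<noteq> y")
    case True
    then have "\<bar>k x y (x - y)\<bar> \<le> K * norm (x - y) powr (- real CARD('n) - \<alpha>)"
      using k by (simp add: singular_kernel_def)
    then have "norm (?F (x, y)) \<le> \<bar>tent x\<^sub>0 \<delta> x - tent x\<^sub>0 \<delta> y\<bar> * (K * norm (x - y) powr (- real CARD('n) - \<alpha>)) * norm (a x y)"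
      using True by (auto simp: kernel_integrand_def abs_mult intro!: mult_mono)
    also have "\<dots> = K * (\<bar>tent x\<^sub>0 \<delta> x - tent x\<^sub>0 \<delta> y\<bar> * norm (x - y) powr (- real CARD('n) - \<alpha>) * norm (a x y))"
      by (simp add: mult_ac)
    also have "\<dots> \<le> K * (near x\<^sub>0 \<delta> x y * h (x - y))"
      using le True K by (intro mult_left_mono) auto
    finally show ?thesis .
  next
    case False
    then show ?thesis
      using K h(2) by (auto simp: kernel_integrand_def near_nonneg)
  qed
  have "(\<integral>\<^sup>+z. norm (?F z) \<partial>(lborel \<Otimes>\<^sub>M lborel)) = (\<integral>\<^sup>+y. \<integral>\<^sup>+x. norm (?F (x, y)) \<partial>lborel \<partial>lborel)"
    using meas by (subst lborel_pair.nn_integral_snd) auto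
  also have "\<dots> \<le> (\<integral>\<^sup>+y. \<integral>\<^sup>+x. ennreal (near x\<^sub>0 \<delta> x y * (K * h (x - y))) \<partial>lborel \<partial>lborel)"
    using pt by (intro nn_integral_mono ennreal_leI) (auto simp: mult_ac)
  also have "\<dots> = 2 * ennreal (?V * \<delta> ^ CARD('n)) * (\<integral>\<^sup>+z. ennreal (K * h z) \<partial>lborel)"
    using K h(2) \<delta> by (subst nn_integral_near_convolution) auto
  also have "(\<integral>\<^sup>+z. ennreal (K * h z) \<partial>lborel) = ennreal K * (\<integral>\<^sup>+z. ennreal (h z) \<partial>lborel)"
    using K h(2) by (simp add: ennreal_mult nn_integral_cmult)
  also have "2 * ennreal (?V * \<delta> ^ CARD('n)) * (ennreal K * (\<integral>\<^sup>+z. ennreal (h z) \<partial>lborel))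
      \<le> 2 * ennreal (?V * \<delta> ^ CARD('n)) * (ennreal K * ennreal c)"
    by (intro mult_left_mono h(3)) auto
  also have "\<dots> = ennreal (2 * K * ?V * \<delta> ^ CARD('n) * c)"
    using K h(4) \<delta> by (simp add: ennreal_mult'[symmetric] ennreal_numeral[symmetric] mult_ac del: ennreal_numeral)
  finally have bound: "(\<integral>\<^sup>+z. norm (?F z) \<partial>(lborel \<Otimes>\<^sub>M lborel)) \<le> ennreal (2 * K * ?V * \<delta> ^ CARD('n) * c)" .
  then show I: ?I
    using meas by (intro integrableI_bounded) (auto intro: le_less_trans)
  have "ennreal (norm (kernel_form \<Omega> k (tent x\<^sub>0 \<delta>) a)) \<le> ennreal (2 * K * ?V * \<delta> ^ CARD('n) * c)"
    unfolding kernel_form_eq[OF \<open>open \<Omega>\<close> I]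
    by (rule order_trans[OF integral_norm_bound_ennreal[OF I] bound])
  then show "norm (kernel_form \<Omega> k (tent x\<^sub>0 \<delta>) a) \<le> 2 * K * ?V * \<delta> ^ CARD('n) * c"
    using K h(4) \<delta> by (subst (asm) ennreal_le_iff) auto
qed

lemma kernel_integrand_tent_integrable:
  fixes a :: "real^'n \<Rightarrow> real^'n \<Rightarrow> 'b::euclidean_space"
  assumes "open \<Omega>" and k: "singular_kernel \<alpha> K k" and \<alpha>: "1 < \<alpha>" "\<alpha> < 2" and \<delta>: "0 < \<delta>"
    and a: "continuous_on (\<Omega> \<times> \<Omega>) (\<lambda>(x, y). a x y)"
    and le: "\<And>x y. x \<in> \<Omega> \<Longrightarrow> y \<in> \<Omega> \<Longrightarrow> norm (a x y) \<le> M * norm (x - y)" and M: "0 \<le> M"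
  shows "integrable (lborel \<Otimes>\<^sub>M lborel) (kernel_integrand \<Omega> k (tent x\<^sub>0 \<delta>) a)"
proof -
  obtain C where C: "0 \<le> C" "\<And>\<delta>. 0 < \<delta> \<Longrightarrow>
      (\<integral>\<^sup>+z. ennreal (weight \<alpha> \<delta> (z::real^'n)) \<partial>lborel) \<le> ennreal (C * \<delta> powr (1 - \<alpha>))"
    using nn_integral_weight_le[OF \<alpha>] by metis
  show ?thesis
  proof (rule kernel_form_tent_bound(1)[OF \<open>open \<Omega>\<close> k \<delta> a, where h = "\<lambda>z. M * weight \<alpha> \<delta> z"
        and c = "M * (C * \<delta> powr (1 - \<alpha>))"])
    show "(\<integral>\<^sup>+z. ennreal (M * weight \<alpha> \<delta> (z::real^'n)) \<partial>lborel) \<le> ennreal (M * (C * \<delta> powr (1 - \<alpha>)))"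
      using M C(2)[OF \<delta>] by (simp add: ennreal_mult' nn_integral_cmult mult_left_mono)
    fix x y assume xy: "x \<in> \<Omega>" "y \<in> \<Omega>" "x \<noteq> y"
    let ?t = "\<bar>tent x\<^sub>0 \<delta> x - tent x\<^sub>0 \<delta> y\<bar>"
    have "?t * norm (x - y) powr (- real CARD('n) - \<alpha>) * norm (a x y)
        \<le> ?t * norm (x - y) powr (- real CARD('n) - \<alpha>) * (M * norm (x - y))"
      using le[OF xy(1,2)] by (intro mult_left_mono) auto
    also have "\<dots> = M * (?t * (norm (x - y) * norm (x - y) powr (- real CARD('n) - \<alpha>)))"
      by (simp add: mult_ac)
    also have "norm (x - y) * norm (x - y) powr (- real CARD('n) - \<alpha>) = norm (x - y) powr (1 - real CARD('n) - \<alpha>)"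
      by (simp add: powr_mult_base algebra_simps)
    also have "M * (?t * norm (x - y) powr (1 - real CARD('n) - \<alpha>)) \<le> M * (near x\<^sub>0 \<delta> x y * weight \<alpha> \<delta> (x - y))"
      using M tent_diff_weight[OF \<delta>, of x\<^sub>0 x y \<alpha>] by (intro mult_left_mono)
    finally show "?t * norm (x - y) powr (- real CARD('n) - \<alpha>) * norm (a x y)
        \<le> near x\<^sub>0 \<delta> x y * (M * weight \<alpha> \<delta> (x - y))" by (simp add: mult_ac)
  qed (use M C(1) \<delta> in \<open>auto simp: weight_nonneg\<close>)
qed

section \<open>Replacing the solution by its linear part at the boundary\<close>

lemma GDERIV_linear_approx:
  fixes u :: "'a::euclidean_space \<Rightarrow> real"
  assumes "convex S" and u: "\<And>x. x \<in> S \<Longrightarrow> GDERIV u x :> D x"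
    and B: "\<And>x. x \<in> S \<Longrightarrow> norm (D x - G) \<le> B" and "x \<in> S" "y \<in> S"
  shows "\<bar>u x - u y - G \<bullet> (x - y)\<bar> \<le> B * norm (x - y)"
proof -
  have "norm ((u x - G \<bullet> x) - (u y - G \<bullet> y)) \<le> B * norm (x - y)"
  proof (rule differentiable_bound[where f = "\<lambda>z. u z - G \<bullet> z" and f' = "\<lambda>z h. h \<bullet> (D z - G)",
        OF \<open>convex S\<close> _ _ \<open>x \<in> S\<close> \<open>y \<in> S\<close>])
    fix z assume z: "z \<in> S"
    have "(u has_derivative (\<lambda>h. h \<bullet> D z)) (at z within S)"
      using u[OF z] by (auto simp: gderiv_def intro: has_derivative_at_withinI)
    then have "((\<lambda>z. u z - G \<bullet> z) has_derivative (\<lambda>h. h \<bullet> D z - G \<bullet> h)) (at z within S)"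
      by (auto intro!: derivative_eq_intros)
    then show "((\<lambda>z. u z - G \<bullet> z) has_derivative (\<lambda>h. h \<bullet> (D z - G))) (at z within S)"
      by (simp add: inner_diff_right inner_commute)
    show "onorm (\<lambda>h. h \<bullet> (D z - G)) \<le> B"
    proof (rule onorm_bound)
      show "0 \<le> B" using B[OF z] norm_ge_zero order_trans by blast
      fix h
      have "norm (h \<bullet> (D z - G)) \<le> norm (D z - G) * norm h"
        using Cauchy_Schwarz_ineq2[of h "D z - G"] by (simp add: mult.commute)
      also have "\<dots> \<le> B * norm h"
        using B[OF z] by (intro mult_right_mono) auto
      finally show "norm (h \<bullet> (D z - G)) \<le> B * norm h" .
    qed
  qed
  then show ?thesis by (simp add: inner_diff_right algebra_simps)
qed

lemma tendsto_powr_at_right_0: "0 < s \<Longrightarrow> ((\<lambda>\<delta>::real. \<delta> powr s) \<longlongrightarrow> 0) (at_right 0)"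
  by (rule tendsto_eq_rhs[OF tendsto_powr2[OF tendsto_ident_at tendsto_const]])
     (auto simp: eventually_at_right_less eventually_mono[OF eventually_at_right_less])

lemma continuous_on_GDERIV_diff:
  assumes u: "\<And>x. x \<in> \<Omega> \<Longrightarrow> GDERIV u x :> D x"
  shows "continuous_on (\<Omega> \<times> \<Omega>) (\<lambda>(x, y). u x - u y)"
proof -
  have u: "continuous_on \<Omega> u"
    using u unfolding gderiv_def by (meson continuous_at_imp_continuous_on has_derivative_continuous)
  show ?thesis
    unfolding case_prod_unfold
    by (auto intro!: continuous_intros continuous_on_compose2[OF u])
qed

text \<open>
  Fix \<open>\<epsilon>\<close> and choose \<open>r\<close> such that the gradient is \<open>\<epsilon>\<close>-close to \<open>G\<close> in the ball of radius \<open>r\<close>. The integrand is bounded by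
  \<open>weight \<alpha> \<delta>\<close> with the factor \<open>\<epsilon>\<close>, for pairs inside this ball, plus \<open>weight \<alpha> (r/2)\<close> with a fixed factor, for
  pairs with one point close to \<open>x\<^sub>0\<close> and the other one outside. After scaling, the first part is \<open>O(\<epsilon>)\<close>
  and the second one is \<open>O(\<delta>\<^bsup>\<alpha>-1\<^esup>)\<close> for fixed \<open>r\<close>.
\<close>

lemma kernel_form_linearisation_error:
  fixes u :: "real^'n \<Rightarrow> real"
  assumes "open \<Omega>" "convex \<Omega>" and k: "singular_kernel \<alpha> K k" and \<alpha>: "1 < \<alpha>" "\<alpha> < 2"
    and u: "\<And>x. x \<in> \<Omega> \<Longrightarrow> GDERIV u x :> D x" and M: "\<And>x. x \<in> \<Omega> \<Longrightarrow> norm (D x) \<le> M"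
    and x0: "x\<^sub>0 \<notin> \<Omega>" and lim: "(D \<longlongrightarrow> G) (at x\<^sub>0 within \<Omega>)"
  shows "((\<lambda>\<delta>. \<delta> powr (\<alpha> - 1 - real CARD('n)) *
      kernel_form \<Omega> k (tent x\<^sub>0 \<delta>) (\<lambda>x y. u x - u y - G \<bullet> (x - y))) \<longlongrightarrow> 0) (at_right 0)"
proof -
  let ?n = "real CARD('n)"
  let ?a = "\<lambda>x y. u x - u y - G \<bullet> (x - y)"
  obtain C where C: "0 \<le> C" "\<And>\<delta>. 0 < \<delta> \<Longrightarrow>
      (\<integral>\<^sup>+z. ennreal (weight \<alpha> \<delta> (z::real^'n)) \<partial>lborel) \<le> ennreal (C * \<delta> powr (1 - \<alpha>))"
    using nn_integral_weight_le[OF \<alpha>] by metis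
  have K: "0 \<le> K" using k by (simp add: singular_kernel_def)
  define Q where "Q = 2 * K * unit_ball_vol ?n * C"
  define M' where "M' = \<bar>M\<bar> + norm G"
  have M': "0 \<le> M'" by (simp add: M'_def)
  have Q: "0 \<le> Q" using K C(1) by (simp add: Q_def)
  have a_cont: "continuous_on (\<Omega> \<times> \<Omega>) (\<lambda>(x, y). ?a x y)"
  proof -
    have "continuous_on (\<Omega> \<times> \<Omega>) (\<lambda>z. G \<bullet> (fst z - snd z))"
      by (intro continuous_intros)
    from continuous_on_diff[OF continuous_on_GDERIV_diff[OF u] this] show ?thesis
      by (simp add: case_prod_unfold)
  qed
  have key: "\<bar>\<delta> powr (\<alpha> - 1 - ?n) * kernel_form \<Omega> k (tent x\<^sub>0 \<delta>) ?a\<bar>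
      \<le> Q * (\<epsilon> + M' * (r/2) powr (1 - \<alpha>) * \<delta> powr (\<alpha> - 1))"
    if \<epsilon>: "0 < \<epsilon>" and r: "\<And>x. x \<in> \<Omega> \<inter> ball x\<^sub>0 r \<Longrightarrow> norm (D x - G) \<le> \<epsilon>" and \<delta>: "0 < \<delta>" "\<delta> < r/2" for \<epsilon> r \<delta>
  proof -
    let ?c = "C * (\<epsilon> * \<delta> powr (1 - \<alpha>) + M' * (r/2) powr (1 - \<alpha>))"
    have "norm (kernel_form \<Omega> k (tent x\<^sub>0 \<delta>) ?a) \<le> 2 * K * unit_ball_vol ?n * \<delta> ^ CARD('n) * ?c"
    proof (rule kernel_form_tent_bound(2)[OF \<open>open \<Omega>\<close> k \<delta>(1) a_cont,
          where h = "\<lambda>z. \<epsilon> * weight \<alpha> \<delta> z + M' * weight \<alpha> (r/2) z"])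
      show "(\<integral>\<^sup>+z. ennreal (\<epsilon> * weight \<alpha> \<delta> (z::real^'n) + M' * weight \<alpha> (r/2) z) \<partial>lborel) \<le> ennreal ?c"
      proof -
        have "(\<integral>\<^sup>+z. ennreal (\<epsilon> * weight \<alpha> \<delta> (z::real^'n) + M' * weight \<alpha> (r/2) z) \<partial>lborel)
            = ennreal \<epsilon> * (\<integral>\<^sup>+z. ennreal (weight \<alpha> \<delta> (z::real^'n)) \<partial>lborel)
              + ennreal M' * (\<integral>\<^sup>+z. ennreal (weight \<alpha> (r/2) (z::real^'n)) \<partial>lborel)"
          using \<epsilon> \<delta> M' by (simp add: ennreal_plus ennreal_mult' weight_nonneg nn_integral_add nn_integral_cmult)
        also have "\<dots> \<le> ennreal \<epsilon> * ennreal (C * \<delta> powr (1 - \<alpha>)) + ennreal M' * ennreal (C * (r/2) powr (1 - \<alpha>))"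
          using \<delta> by (intro add_mono mult_left_mono C(2)) auto
        also have "\<dots> = ennreal ?c"
          using \<epsilon> \<delta> M' C(1) by (simp add: ennreal_mult'[symmetric] ennreal_plus[symmetric] algebra_simps del: ennreal_plus)
        finally show ?thesis .
      qed
      fix x y assume xy: "x \<in> \<Omega>" "y \<in> \<Omega>" "x \<noteq> y"
      let ?t = "\<bar>tent x\<^sub>0 \<delta> x - tent x\<^sub>0 \<delta> y\<bar>"
      let ?p = "norm (x - y) powr (- ?n - \<alpha>)"
      have p: "?p * norm (x - y) = norm (x - y) powr (1 - ?n - \<alpha>)"
        by (simp add: mult.commute powr_mult_base algebra_simps)
      have w: "0 \<le> near x\<^sub>0 \<delta> x y * (\<epsilon> * weight \<alpha> \<delta> (x - y))" "0 \<le> near x\<^sub>0 \<delta> x y * (M' * weight \<alpha> (r/2) (x - y))"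
        using \<epsilon> \<delta> M' by (simp_all add: near_nonneg weight_nonneg)
      \<comment> \<open>as \<open>\<delta> < r/2\<close>, a point in the small ball is at distance at least \<open>r/2\<close> from the complement of the large one\<close>
      consider "x \<in> ball x\<^sub>0 r" "y \<in> ball x\<^sub>0 r" | "x \<notin> ball x\<^sub>0 \<delta>" "y \<notin> ball x\<^sub>0 \<delta>"
        | "r/2 \<le> norm (x - y)"
      proof -
        have "r/2 \<le> norm (x - y)" if "x \<in> ball x\<^sub>0 \<delta>" "y \<notin> ball x\<^sub>0 r" for x y
          using that \<delta> dist_triangle[of x\<^sub>0 y x] by (simp add: dist_norm norm_minus_commute)
        from this[of x y] this[of y x] show ?thesis
          by (cases "dist x\<^sub>0 x < \<delta>"; cases "dist x\<^sub>0 y < \<delta>"; cases "dist x\<^sub>0 x < r"; cases "dist x\<^sub>0 y < r")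
             (use \<delta> that in \<open>auto simp: norm_minus_commute\<close>)
      qed
      then show "?t * ?p * norm (?a x y) \<le> near x\<^sub>0 \<delta> x y * (\<epsilon> * weight \<alpha> \<delta> (x - y) + M' * weight \<alpha> (r/2) (x - y))"
      proof cases
        case 1
        then have "\<bar>?a x y\<bar> \<le> \<epsilon> * norm (x - y)"
          using xy by (intro GDERIV_linear_approx[where S = "\<Omega> \<inter> ball x\<^sub>0 r" and D = D])
             (auto intro!: convex_Int \<open>convex \<Omega>\<close> u r)
        then have "?t * ?p * norm (?a x y) \<le> ?t * ?p * (\<epsilon> * norm (x - y))"
          by (intro mult_left_mono) auto
        also have "\<dots> = \<epsilon> * (?t * (?p * norm (x - y)))" by (simp add: mult_ac)
        also have "\<dots> \<le> \<epsilon> * (near x\<^sub>0 \<delta> x y * weight \<alpha> \<delta> (x - y))"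
          unfolding p using \<epsilon> tent_diff_weight[OF \<delta>(1), of x\<^sub>0 x y \<alpha>] by (intro mult_left_mono) auto
        finally show ?thesis using w by (simp add: algebra_simps)
      next
        case 2
        then have "?t = 0"
          by (simp add: tent_def dist_norm norm_minus_commute)
        then show ?thesis using w by (simp add: algebra_simps)
      next
        case 3
        have "norm (D z - G) \<le> M'" if "z \<in> \<Omega>" for z
          using M[OF that] norm_triangle_ineq4[of "D z" G] by (simp add: M'_def)
        then have "\<bar>?a x y\<bar> \<le> M' * norm (x - y)"
          using xy by (intro GDERIV_linear_approx[where S = \<Omega> and D = D]) (auto intro!: \<open>convex \<Omega>\<close> u)
        then have "?t * ?p * norm (?a x y) \<le> ?t * ?p * (M' * norm (x - y))"
          by (intro mult_left_mono) auto
        also have "\<dots> = M' * (?t * (?p * norm (x - y)))" by (simp add: mult_ac)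
        also have "\<dots> \<le> M' * (near x\<^sub>0 \<delta> x y * weight \<alpha> (r/2) (x - y))"
          unfolding p using M' \<delta> 3 tent_diff_weight_far[OF \<delta>(1), of "r/2" x y x\<^sub>0 \<alpha>] by (intro mult_left_mono) auto
        finally show ?thesis using w by (simp add: algebra_simps)
      qed
    qed (use \<epsilon> \<delta> M' C(1) in \<open>auto simp: weight_nonneg\<close>)
    then have "\<bar>\<delta> powr (\<alpha> - 1 - ?n) * kernel_form \<Omega> k (tent x\<^sub>0 \<delta>) ?a\<bar>
        \<le> \<delta> powr (\<alpha> - 1 - ?n) * (2 * K * unit_ball_vol ?n * \<delta> ^ CARD('n) * ?c)"
      by (simp add: abs_mult mult_left_mono)
    also have "\<dots> = Q * ((\<delta> powr (\<alpha> - 1 - ?n) * \<delta> ^ CARD('n) * \<delta> powr (1 - \<alpha>)) * \<epsilon> +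
        M' * (r/2) powr (1 - \<alpha>) * (\<delta> powr (\<alpha> - 1 - ?n) * \<delta> ^ CARD('n)))"
      by (simp add: Q_def algebra_simps)
    also have "\<delta> powr (\<alpha> - 1 - ?n) * \<delta> ^ CARD('n) = \<delta> powr (\<alpha> - 1)"
      using \<delta> by (simp add: powr_realpow[symmetric] powr_add[symmetric])
    also have "\<delta> powr (\<alpha> - 1) * \<delta> powr (1 - \<alpha>) = 1"
      using \<delta> by (simp add: powr_add[symmetric])
    finally show ?thesis by simp
  qed
  show ?thesis
  proof (rule tendstoI)
    fix e :: real assume e: "0 < e"
    \<comment> \<open>\<open>Q\<close> may vanish, hence \<open>Q + 1\<close>\<close>
    define \<epsilon> where "\<epsilon> = e / (Q + 1)"
    have \<epsilon>: "0 < \<epsilon>" "Q * \<epsilon> < e"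
      using Q e by (auto simp: \<epsilon>_def field_simps)
    obtain r where r: "0 < r" "\<And>x. x \<in> \<Omega> \<inter> ball x\<^sub>0 r \<Longrightarrow> norm (D x - G) \<le> \<epsilon>"
      using lim \<epsilon>(1) x0 unfolding tendsto_iff eventually_at
      by (fastforce simp: dist_norm norm_minus_commute less_imp_le)
    have "((\<lambda>\<delta>. Q * (\<epsilon> + M' * (r/2) powr (1 - \<alpha>) * \<delta> powr (\<alpha> - 1))) \<longlongrightarrow> Q * (\<epsilon> + M' * (r/2) powr (1 - \<alpha>) * 0)) (at_right 0)"
      using \<alpha> by (intro tendsto_intros tendsto_powr_at_right_0) auto
    then have "\<forall>\<^sub>F \<delta> in at_right 0. Q * (\<epsilon> + M' * (r/2) powr (1 - \<alpha>) * \<delta> powr (\<alpha> - 1)) < e"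
      using \<epsilon>(2) by (intro order_tendstoD) auto
    moreover have "\<forall>\<^sub>F \<delta> in at_right 0. 0 < \<delta> \<and> \<delta> < r/2"
      using r(1) by (auto simp: eventually_at_right intro!: exI[of _ "r/2"])
    ultimately show "\<forall>\<^sub>F \<delta> in at_right 0.
        dist (\<delta> powr (\<alpha> - 1 - ?n) * kernel_form \<Omega> k (tent x\<^sub>0 \<delta>) ?a) 0 < e"
    proof eventually_elim
      case (elim \<delta>)
      with key[OF \<epsilon>(1) r(2), of r \<delta>] show ?case by (simp add: dist_norm)
    qed
  qed
qed

section \<open>Integrals of tents and of data against tents\<close>

lemma integrable_indicator_ball:
  fixes x\<^sub>0 :: "'a::euclidean_space"
  assumes "open \<Omega>" "0 \<le> R"
  shows "integrable (lebesgue_on \<Omega>) (indicator (ball x\<^sub>0 R) :: 'a \<Rightarrow> real)"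
    and "(LINT x|lebesgue_on \<Omega>. indicator (ball x\<^sub>0 R) x) \<le> unit_ball_vol (DIM('a)) * R ^ DIM('a)"
proof -
  have \<Omega>: "\<Omega> \<inter> space lebesgue \<in> sets lebesgue" using assms by simp
  have m: "\<Omega> \<inter> ball x\<^sub>0 R \<in> lmeasurable"
    using assms by (intro lmeasurable_open) (auto intro: bounded_subset[OF bounded_ball])
  have eq: "(\<lambda>x. indicator \<Omega> x *\<^sub>R indicator (ball x\<^sub>0 R) x) = (indicator (\<Omega> \<inter> ball x\<^sub>0 R) :: 'a \<Rightarrow> real)"
    by (auto simp: indicator_def)
  show "integrable (lebesgue_on \<Omega>) (indicator (ball x\<^sub>0 R) :: 'a \<Rightarrow> real)"
    using m unfolding integrable_restrict_space[OF \<Omega>] eq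
    by (intro integrable_real_indicator) (auto simp: fmeasurable_def)
  have "(LINT x|lebesgue_on \<Omega>. indicator (ball x\<^sub>0 R) x) = measure lebesgue (\<Omega> \<inter> ball x\<^sub>0 R)"
    unfolding integral_restrict_space[OF \<Omega>] eq by simp
  also have "\<dots> \<le> measure lebesgue (ball x\<^sub>0 R)"
    using m by (intro measure_mono_fmeasurable) auto
  also have "\<dots> = unit_ball_vol (DIM('a)) * R ^ DIM('a)"
    using assms by (simp add: content_ball)
  finally show "(LINT x|lebesgue_on \<Omega>. indicator (ball x\<^sub>0 R) x) \<le> unit_ball_vol (DIM('a)) * R ^ DIM('a)" .
qed

lemma measurable_tent:
  "open \<Omega> \<Longrightarrow> 0 < \<delta> \<Longrightarrow> tent x\<^sub>0 \<delta> \<in> borel_measurable (lebesgue_on \<Omega>)"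
  by (intro continuous_imp_measurable_on_sets_lebesgue continuous_on_tent) auto

lemma integrable_tent:
  fixes x\<^sub>0 :: "real^'n"
  assumes "open \<Omega>" "0 < \<delta>"
  shows "integrable (lebesgue_on \<Omega>) (tent x\<^sub>0 \<delta>)"
    and "\<bar>LINT x|lebesgue_on \<Omega>. tent x\<^sub>0 \<delta> x\<bar> \<le> unit_ball_vol (real CARD('n)) * \<delta> ^ CARD('n)"
proof -
  note ball = integrable_indicator_ball[OF assms(1) less_imp_le[OF assms(2)], of x\<^sub>0]
  show I: "integrable (lebesgue_on \<Omega>) (tent x\<^sub>0 \<delta>)"
    using tent_bounds[OF assms(2), of x\<^sub>0]
    by (intro Bochner_Integration.integrable_bound[OF ball(1) measurable_tent[OF assms]]) auto
  have "(LINT x|lebesgue_on \<Omega>. tent x\<^sub>0 \<delta> x) \<le> (LINT x|lebesgue_on \<Omega>. indicator (ball x\<^sub>0 \<delta>) x)"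
    using tent_bounds[OF assms(2), of x\<^sub>0] by (intro integral_mono I ball) auto
  moreover have "0 \<le> (LINT x|lebesgue_on \<Omega>. tent x\<^sub>0 \<delta> x)"
    using tent_bounds[OF assms(2), of x\<^sub>0] by (intro Bochner_Integration.integral_nonneg) auto
  ultimately show "\<bar>LINT x|lebesgue_on \<Omega>. tent x\<^sub>0 \<delta> x\<bar> \<le> unit_ball_vol (real CARD('n)) * \<delta> ^ CARD('n)"
    using ball(2) by simp
qed

lemma integral_tent_pos:
  fixes x\<^sub>0 :: "real^'n"
  assumes "open \<Omega>" "0 < \<delta>" and x0: "x\<^sub>0 \<in> closure \<Omega>"
  shows "0 < (LINT x|lebesgue_on \<Omega>. tent x\<^sub>0 \<delta> x)"
proof (rule ccontr)
  assume "\<not> ?thesis"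
  moreover have nn: "0 \<le> tent x\<^sub>0 \<delta> x" for x
    using tent_bounds[OF assms(2), of x\<^sub>0 x] by simp
  then have "0 \<le> (LINT x|lebesgue_on \<Omega>. tent x\<^sub>0 \<delta> x)"
    by (intro Bochner_Integration.integral_nonneg)
  ultimately have "(LINT x|lebesgue_on \<Omega>. tent x\<^sub>0 \<delta> x) = 0" by simp
  then have "AE x in lebesgue_on \<Omega>. tent x\<^sub>0 \<delta> x = 0"
    using integral_nonneg_eq_0_iff_AE[OF integrable_tent(1)[OF assms(1,2)], of x\<^sub>0] nn by simp
  then have "AE x in lebesgue. x \<in> \<Omega> \<longrightarrow> tent x\<^sub>0 \<delta> x = 0"
    using assms(1) by (subst (asm) AE_restrict_space_iff) auto
  then have "AE x in lebesgue. x \<notin> \<Omega> \<inter> ball x\<^sub>0 \<delta>"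
    by eventually_elim (use assms(2) in \<open>auto simp: tent_def dist_norm norm_minus_commute field_simps\<close>)
  moreover have op: "open (\<Omega> \<inter> ball x\<^sub>0 \<delta>)" using assms(1) by auto
  ultimately have "negligible (\<Omega> \<inter> ball x\<^sub>0 \<delta>)"
    using AE_iff_null_sets[of "\<Omega> \<inter> ball x\<^sub>0 \<delta>" lebesgue]
    by (simp add: negligible_iff_null_sets)
  moreover have "\<Omega> \<inter> ball x\<^sub>0 \<delta> \<noteq> {}"
    using x0 assms(2) by (auto simp: closure_approachable dist_commute disjoint_iff)
  ultimately show False
    using open_not_negligible[OF op] by blast
qed

text \<open>
  The exponent \<open>s'\<close> is \<open>n/p\<close>. Instead of Hoelder's inequality, the proof for finite \<open>p\<close> uses
  \<open>\<bar>g\<bar> \<le> l + l\<^bsup>1-p\<^esup> \<bar>g\<bar>\<^sup>p\<close>, valid for every \<open>l > 0\<close>, and integrates it over the ball of radius \<open>\<delta>\<close>; for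
  \<open>l = \<delta>\<^bsup>-n/p\<^esup>\<close> both terms are of the order \<open>\<delta>\<^bsup>n-n/p\<^esup>\<close>.
\<close>

lemma Lp_tent_bound:
  fixes g :: "real^'n \<Rightarrow> real"
  assumes "open \<Omega>" and p: "1 \<le> p" "ereal (real CARD('n)) / p < ereal s" "s \<le> real CARD('n)" and g: "g \<in> Lp p \<Omega>"
  obtains A s' where "0 \<le> A" "s' < s"
    "\<And>\<delta>. 0 < \<delta> \<Longrightarrow> integrable (lebesgue_on \<Omega>) (\<lambda>x. g x * tent x\<^sub>0 \<delta> x)"
    "\<And>\<delta>. 0 < \<delta> \<Longrightarrow> \<bar>LINT x|lebesgue_on \<Omega>. g x * tent x\<^sub>0 \<delta> x\<bar> \<le> A * \<delta> powr (real CARD('n) - s')"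
proof -
  let ?n = "real CARD('n)"
  let ?V = "unit_ball_vol ?n"
  have [measurable]: "g \<in> borel_measurable (lebesgue_on \<Omega>)"
    using g by (simp add: Lp_def)
  have meas: "(\<lambda>x. g x * tent x\<^sub>0 \<delta> x) \<in> borel_measurable (lebesgue_on \<Omega>)" if "0 < \<delta>" for \<delta>
    using measurable_tent[OF \<open>open \<Omega>\<close> that, of x\<^sub>0] by measurable
  consider "p = \<infinity>" | q where "p = ereal q" "1 \<le> q"
    using p(1) by (cases p) auto
  then show thesis
  proof cases
    case 1
    then obtain B where B: "AE x in lebesgue_on \<Omega>. \<bar>g x\<bar> \<le> B"
      using g by (auto simp: Lp_def)
    show thesis
    proof (rule that[of "\<bar>B\<bar> * ?V" 0])
      show "0 < s" using p(2) 1 by (simp add: zero_ereal_def)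
      fix \<delta> :: real assume \<delta>: "0 < \<delta>"
      have le: "AE x in lebesgue_on \<Omega>. norm (g x * tent x\<^sub>0 \<delta> x) \<le> \<bar>B\<bar> * indicator (ball x\<^sub>0 \<delta>) x"
        using B by eventually_elim (use tent_bounds[OF \<delta>, of x\<^sub>0] in \<open>auto simp: abs_mult intro!: mult_mono\<close>)
      have ball: "integrable (lebesgue_on \<Omega>) (\<lambda>x. \<bar>B\<bar> * indicator (ball x\<^sub>0 \<delta>) x)"
        using \<delta> \<open>open \<Omega>\<close> by (intro integrable_mult_right integrable_indicator_ball) auto
      show I: "integrable (lebesgue_on \<Omega>) (\<lambda>x. g x * tent x\<^sub>0 \<delta> x)"
        by (rule Bochner_Integration.integrable_bound[OF ball meas[OF \<delta>]]) (use le in auto)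
      have "\<bar>LINT x|lebesgue_on \<Omega>. g x * tent x\<^sub>0 \<delta> x\<bar> \<le> (LINT x|lebesgue_on \<Omega>. norm (g x * tent x\<^sub>0 \<delta> x))"
        using integral_norm_bound[of "lebesgue_on \<Omega>" "\<lambda>x. g x * tent x\<^sub>0 \<delta> x"] by simp
      also have "\<dots> \<le> (LINT x|lebesgue_on \<Omega>. \<bar>B\<bar> * indicator (ball x\<^sub>0 \<delta>) x)"
        using le I ball by (intro integral_mono_AE) auto
      also have "\<dots> \<le> \<bar>B\<bar> * (?V * \<delta> ^ CARD('n))"
        using integrable_indicator_ball(2)[OF \<open>open \<Omega>\<close>, of \<delta> x\<^sub>0] \<delta> by (auto intro!: mult_left_mono)
      finally show "\<bar>LINT x|lebesgue_on \<Omega>. g x * tent x\<^sub>0 \<delta> x\<bar> \<le> \<bar>B\<bar> * ?V * \<delta> powr (?n - 0)"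
        using \<delta> by (simp add: powr_realpow mult.assoc)
    qed auto
  next
    case (2 q)
    define N where "N = (LINT x|lebesgue_on \<Omega>. \<bar>g x\<bar> powr q)"
    have gq: "integrable (lebesgue_on \<Omega>) (\<lambda>x. \<bar>g x\<bar> powr q)"
      using g 2 by (simp add: Lp_def)
    have N: "0 \<le> N" by (simp add: N_def)
    show thesis
    proof (rule that[of "?V + N" "?n / q"])
      show "?n / q < s" using p(2) 2 by simp
      fix \<delta> :: real assume \<delta>: "0 < \<delta>"
      \<comment> \<open>the threshold that balances the two terms of \<open>?h\<close>\<close>
      define l where "l = \<delta> powr (- ?n / q)"
      have l: "0 < l" using \<delta> by (simp add: l_def)
      let ?h = "\<lambda>x. l * indicator (ball x\<^sub>0 \<delta>) x + l powr (1 - q) * \<bar>g x\<bar> powr q"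
      have le: "norm (g x * tent x\<^sub>0 \<delta> x) \<le> ?h x" for x
      proof (cases "x \<in> ball x\<^sub>0 \<delta>")
        case True
        have "\<bar>g x\<bar> \<le> l + l powr (1 - q) * \<bar>g x\<bar> powr q"
        proof (cases "\<bar>g x\<bar> \<le> l")
          case False
          then have "\<bar>g x\<bar> = \<bar>g x\<bar> powr (1 - q) * \<bar>g x\<bar> powr q"
            using l by (simp add: powr_add[symmetric])
          also have "\<dots> \<le> l powr (1 - q) * \<bar>g x\<bar> powr q"
            using False l 2 by (intro mult_right_mono powr_mono2') auto
          finally show ?thesis using l by simp
        qed (simp add: add_increasing2)
        moreover have "norm (g x * tent x\<^sub>0 \<delta> x) \<le> \<bar>g x\<bar> * 1"
          unfolding norm_mult using tent_bounds[OF \<delta>, of x\<^sub>0 x] True by (intro mult_mono) auto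
        ultimately show ?thesis using True by simp
      next
        case False
        then show ?thesis by (simp add: tent_def dist_norm norm_minus_commute)
      qed
      have h: "integrable (lebesgue_on \<Omega>) ?h"
        using \<delta> \<open>open \<Omega>\<close> gq by (intro Bochner_Integration.integrable_add integrable_mult_right integrable_indicator_ball) auto
      show I: "integrable (lebesgue_on \<Omega>) (\<lambda>x. g x * tent x\<^sub>0 \<delta> x)"
        using le by (intro Bochner_Integration.integrable_bound[OF h meas[OF \<delta>]]) (auto intro!: AE_I2 order_trans[OF _ abs_ge_self])
      have "\<bar>LINT x|lebesgue_on \<Omega>. g x * tent x\<^sub>0 \<delta> x\<bar> \<le> (LINT x|lebesgue_on \<Omega>. norm (g x * tent x\<^sub>0 \<delta> x))"
        using integral_norm_bound[of "lebesgue_on \<Omega>" "\<lambda>x. g x * tent x\<^sub>0 \<delta> x"] by simp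
      also have "\<dots> \<le> (LINT x|lebesgue_on \<Omega>. ?h x)"
        using le I h by (intro integral_mono) auto
      also have "\<dots> = l * (LINT x|lebesgue_on \<Omega>. indicator (ball x\<^sub>0 \<delta>) x) + l powr (1 - q) * N"
        using \<delta> \<open>open \<Omega>\<close> gq by (subst Bochner_Integration.integral_add)
          (auto simp: N_def intro!: integrable_mult_right integrable_indicator_ball)
      also have "\<dots> \<le> l * (?V * \<delta> ^ CARD('n)) + l powr (1 - q) * N"
        using integrable_indicator_ball(2)[OF \<open>open \<Omega>\<close>, of \<delta> x\<^sub>0] \<delta> l by (auto intro!: mult_left_mono)
      also have "l * (?V * \<delta> ^ CARD('n)) = ?V * \<delta> powr (?n - ?n / q)"
        using \<delta> by (simp add: l_def powr_realpow[symmetric] powr_add[symmetric])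
      also have "l powr (1 - q) = \<delta> powr (?n - ?n / q)"
      proof -
        have "- ?n / q * (1 - q) = ?n - ?n / q" using 2 by (simp add: field_simps)
        then show ?thesis by (simp only: l_def powr_powr)
      qed
      finally show "\<bar>LINT x|lebesgue_on \<Omega>. g x * tent x\<^sub>0 \<delta> x\<bar> \<le> (?V + N) * \<delta> powr (?n - ?n / q)"
        by (simp add: algebra_simps)
    qed (use N in auto)
  qed
qed

section \<open>Tents as test functions\<close>

text \<open>
  With one of the two factors \<open>\<bar>f x - f y\<bar>\<close> bounded by a multiple of \<open>\<bar>x - y\<bar>\<close>, the difference quotient in the seminorm is
  bounded by a multiple of the weight.
\<close>

lemma near_lipschitz_imp_Hs:
  fixes f :: "real^'n \<Rightarrow> real"
  assumes "open \<Omega>" and \<alpha>: "1 < \<alpha>" "\<alpha> < 2" and "0 < R" and f: "continuous_on UNIV f"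
    and bd: "\<And>x. \<bar>f x\<bar> \<le> B * indicator (ball x\<^sub>0 R) x"
    and lip: "\<And>x y. \<bar>f x - f y\<bar> \<le> L * (near x\<^sub>0 R x y * min (norm (x - y)) 1)"
  shows "f \<in> Hs (\<alpha>/2) \<Omega>"
proof -
  let ?n = "real CARD('n)"
  have meas: "f \<in> borel_measurable (lebesgue_on \<Omega>)"
    using f \<open>open \<Omega>\<close> by (intro continuous_imp_measurable_on_sets_lebesgue) (auto intro: continuous_on_subset)
  have "integrable (lebesgue_on \<Omega>) (\<lambda>x. \<bar>f x\<bar> powr 2)"
  proof (rule Bochner_Integration.integrable_bound)
    show "integrable (lebesgue_on \<Omega>) (\<lambda>x. B\<^sup>2 * indicator (ball x\<^sub>0 R) x)"
      using \<open>open \<Omega>\<close> \<open>0 < R\<close> by (intro integrable_mult_right integrable_indicator_ball) auto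
    have "norm (\<bar>f x\<bar> powr 2) \<le> norm (B\<^sup>2 * indicator (ball x\<^sub>0 R) x)" for x
      using power_mono[OF bd[of x], of 2] by (cases "x \<in> ball x\<^sub>0 R") auto
    then show "AE x in lebesgue_on \<Omega>. norm (\<bar>f x\<bar> powr 2) \<le> norm (B\<^sup>2 * indicator (ball x\<^sub>0 R) x)"
      by simp
  qed (use meas in measurable)
  with meas have Lp: "f \<in> Lp 2 \<Omega>"
    by (simp add: Lp_def)
  have quotient: "\<bar>f x - f y\<bar>\<^sup>2 / norm (x - y) powr (?n + 2 * (\<alpha>/2))
      \<le> near x\<^sub>0 R x y * (2 * L\<^sup>2 * weight \<alpha> 1 (x - y))" for x y
  proof -
    let ?m = "min (norm (x - y)) 1" and ?w = "near x\<^sub>0 R x y"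
    \<comment> \<open>in one copy of \<open>near * min\<close>, use \<open>near \<le> 2\<close> and \<open>min \<le> norm (x - y)\<close>\<close>
    have "\<bar>f x - f y\<bar>\<^sup>2 \<le> (L * (?w * ?m))\<^sup>2"
      using lip[of x y] by (intro power_mono) auto
    also have "\<dots> = (L\<^sup>2 * ?w * ?m) * (?w * ?m)" by (simp add: power2_eq_square mult_ac)
    also have "\<dots> \<le> (L\<^sup>2 * ?w * ?m) * (2 * norm (x - y))"
      by (intro mult_left_mono mult_mono) (auto simp: near_nonneg near_def indicator_def)
    finally have "\<bar>f x - f y\<bar>\<^sup>2 * norm (x - y) powr (- ?n - \<alpha>)
        \<le> (L\<^sup>2 * ?w * ?m) * (2 * norm (x - y)) * norm (x - y) powr (- ?n - \<alpha>)"
      by (intro mult_right_mono) auto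
    also have "\<dots> = ?w * (2 * L\<^sup>2 * (?m * (norm (x - y) * norm (x - y) powr (- ?n - \<alpha>))))"
      by (simp add: mult_ac)
    also have "\<dots> = ?w * (2 * L\<^sup>2 * weight \<alpha> 1 (x - y))"
      by (simp add: weight_def powr_mult_base algebra_simps)
    also have "norm (x - y) powr (- ?n - \<alpha>) = inverse (norm (x - y) powr (?n + 2 * (\<alpha>/2)))"
      by (simp add: powr_minus[symmetric])
    finally show ?thesis
      by (simp only: divide_inverse)
  qed
  have \<Omega>: "\<Omega> \<in> sets borel" using \<open>open \<Omega>\<close> by simp
  have "(\<integral>\<^sup>+y. \<integral>\<^sup>+x. ennreal (\<bar>f x - f y\<bar>\<^sup>2 / norm (x - y) powr (?n + 2 * (\<alpha>/2)))
         \<partial>lebesgue_on \<Omega> \<partial>lebesgue_on \<Omega>)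
      \<le> (\<integral>\<^sup>+y. \<integral>\<^sup>+x. ennreal (near x\<^sub>0 R x y * (2 * L\<^sup>2 * weight \<alpha> 1 (x - y))) \<partial>lborel \<partial>lborel)"
    by (intro nn_integral_lebesgue_on_le[OF \<Omega>] ennreal_leI quotient)
  also have "\<dots> = 2 * ennreal (unit_ball_vol ?n * R ^ CARD('n)) * (\<integral>\<^sup>+z. ennreal (2 * L\<^sup>2 * weight \<alpha> 1 (z::real^'n)) \<partial>lborel)"
    using \<open>0 < R\<close> by (subst nn_integral_near_convolution) (auto simp: weight_nonneg)
  also have "(\<integral>\<^sup>+z. ennreal (2 * L\<^sup>2 * weight \<alpha> 1 (z::real^'n)) \<partial>lborel)
      = ennreal (2 * L\<^sup>2) * (\<integral>\<^sup>+z. ennreal (weight \<alpha> 1 (z::real^'n)) \<partial>lborel)"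
    by (simp add: ennreal_mult' weight_nonneg nn_integral_cmult)
  also have "2 * ennreal (unit_ball_vol ?n * R ^ CARD('n)) * \<dots> < \<infinity>"
    using nn_integral_weight_finite[OF \<alpha>, where 'a = "real^'n"] by (simp add: ennreal_mult_less_top)
  finally show ?thesis
    using Lp by (simp add: Hs_def)
qed

lemma tent_combination_in_Hs:
  fixes x\<^sub>0 :: "real^'n"
  assumes "open \<Omega>" and \<alpha>: "1 < \<alpha>" "\<alpha> < 2" and \<delta>: "0 < \<delta>"
  shows "(\<lambda>x. tent x\<^sub>0 \<delta> x - c * tent x\<^sub>0 1 x) \<in> Hs (\<alpha>/2) \<Omega>"
proof (rule near_lipschitz_imp_Hs[OF \<open>open \<Omega>\<close> \<alpha>, where R = "max \<delta> 1" and x\<^sub>0 = x\<^sub>0 and B = "1 + \<bar>c\<bar>"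
      and L = "max (1/\<delta>) 1 + \<bar>c\<bar>"])
  show "continuous_on UNIV (\<lambda>x. tent x\<^sub>0 \<delta> x - c * tent x\<^sub>0 1 x)"
    using \<delta> by (intro continuous_intros continuous_on_tent) auto
  have near_mono: "near x\<^sub>0 r x y \<le> near x\<^sub>0 (max \<delta> 1) x y" if "r \<le> max \<delta> 1" for r x y
    unfolding near_def using that by (intro add_mono) (auto simp: indicator_def)
  show "\<bar>tent x\<^sub>0 \<delta> x - c * tent x\<^sub>0 1 x\<bar> \<le> (1 + \<bar>c\<bar>) * indicator (ball x\<^sub>0 (max \<delta> 1)) x" for x
  proof -
    have "tent x\<^sub>0 r x \<le> indicator (ball x\<^sub>0 (max \<delta> 1)) x" if "r \<le> max \<delta> 1" "0 < r" for r
    proof -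
      have "indicator (ball x\<^sub>0 r) x \<le> (indicator (ball x\<^sub>0 (max \<delta> 1)) x :: real)"
        using that by (auto simp: indicator_def)
      with tent_bounds[OF that(2), of x\<^sub>0 x] show ?thesis by linarith
    qed
    from this[of \<delta>] this[of 1] \<delta>
    have "tent x\<^sub>0 \<delta> x \<le> indicator (ball x\<^sub>0 (max \<delta> 1)) x"
      "\<bar>c\<bar> * tent x\<^sub>0 1 x \<le> \<bar>c\<bar> * indicator (ball x\<^sub>0 (max \<delta> 1)) x"
      by (auto intro!: mult_left_mono)
    moreover have "\<bar>tent x\<^sub>0 \<delta> x - c * tent x\<^sub>0 1 x\<bar> \<le> tent x\<^sub>0 \<delta> x + \<bar>c\<bar> * tent x\<^sub>0 1 x"
      using tent_bounds[OF \<delta>, of x\<^sub>0 x] tent_bounds[of 1 x\<^sub>0 x] abs_triangle_ineq4[of "tent x\<^sub>0 \<delta> x" "c * tent x\<^sub>0 1 x"]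
      by (simp add: abs_mult)
    ultimately show ?thesis by (simp add: distrib_right)
  qed
  show "\<bar>(tent x\<^sub>0 \<delta> x - c * tent x\<^sub>0 1 x) - (tent x\<^sub>0 \<delta> y - c * tent x\<^sub>0 1 y)\<bar>
      \<le> (max (1/\<delta>) 1 + \<bar>c\<bar>) * (near x\<^sub>0 (max \<delta> 1) x y * min (norm (x - y)) 1)" for x y
  proof -
    let ?w = "near x\<^sub>0 (max \<delta> 1) x y" and ?m = "min (norm (x - y)) 1"
    have "min (norm (x - y) / \<delta>) 1 \<le> max (1/\<delta>) 1 * ?m"
    proof (cases "norm (x - y) \<le> 1")
      case True
      have "norm (x - y) * (1/\<delta>) \<le> norm (x - y) * max (1/\<delta>) 1" by (intro mult_left_mono) auto
      with True show ?thesis by (simp add: mult.commute)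
    qed auto
    then have "near x\<^sub>0 \<delta> x y * min (norm (x - y) / \<delta>) 1 \<le> ?w * (max (1/\<delta>) 1 * ?m)"
      using \<delta> by (intro mult_mono near_mono) (auto simp: near_nonneg)
    with abs_tent_diff_le[OF \<delta>, of x\<^sub>0 x y] have 1: "\<bar>tent x\<^sub>0 \<delta> x - tent x\<^sub>0 \<delta> y\<bar> \<le> max (1/\<delta>) 1 * (?w * ?m)"
      by (simp add: mult_ac)
    have "near x\<^sub>0 1 x y * min (norm (x - y) / 1) 1 \<le> ?w * ?m"
      by (intro mult_mono near_mono) (auto simp: near_nonneg)
    with abs_tent_diff_le[of 1 x\<^sub>0 x y] have "\<bar>tent x\<^sub>0 1 x - tent x\<^sub>0 1 y\<bar> \<le> ?w * ?m"
      by simp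
    then have 2: "\<bar>c * (tent x\<^sub>0 1 x - tent x\<^sub>0 1 y)\<bar> \<le> \<bar>c\<bar> * (?w * ?m)"
      unfolding abs_mult by (intro mult_left_mono) auto
    have "\<bar>(tent x\<^sub>0 \<delta> x - c * tent x\<^sub>0 1 x) - (tent x\<^sub>0 \<delta> y - c * tent x\<^sub>0 1 y)\<bar>
        = \<bar>(tent x\<^sub>0 \<delta> x - tent x\<^sub>0 \<delta> y) - c * (tent x\<^sub>0 1 x - tent x\<^sub>0 1 y)\<bar>"
      by (simp add: algebra_simps)
    also have "\<dots> \<le> max (1/\<delta>) 1 * (?w * ?m) + \<bar>c\<bar> * (?w * ?m)"
      using 1 2 by linarith
    finally show ?thesis by (simp add: distrib_right)
  qed
qed (use \<delta> in simp)

lemma energy_form_eq_kernel_form: "energy_form \<Omega> k u \<psi> = 1/2 * kernel_form \<Omega> k \<psi> (\<lambda>x y. u x - u y)"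
  by (simp add: energy_form_def kernel_form_def mult_ac)

lemma scaled_tent_moment_eq:
  fixes x\<^sub>0 :: "real^'n"
  shows "scaled_tent_moment \<alpha> \<Omega> k x\<^sub>0 \<delta> = \<delta> powr (\<alpha> - 1 - real CARD('n)) *\<^sub>R kernel_form \<Omega> k (tent x\<^sub>0 \<delta>) (\<lambda>x y. x - y)"
  by (simp add: scaled_tent_moment_def kernel_form_def add.commute add_diff_eq)

lemma kernel_form_diff_left:
  assumes "open \<Omega>" and I: "integrable (lborel \<Otimes>\<^sub>M lborel) (kernel_integrand \<Omega> k \<phi> a)"
      "integrable (lborel \<Otimes>\<^sub>M lborel) (kernel_integrand \<Omega> k \<psi> a)"
  shows "kernel_form \<Omega> k (\<lambda>x. \<phi> x - c * \<psi> x) a = kernel_form \<Omega> k \<phi> a - c *\<^sub>R kernel_form \<Omega> k \<psi> a"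
proof -
  have eq: "kernel_integrand \<Omega> k (\<lambda>x. \<phi> x - c * \<psi> x) a
      = (\<lambda>z. kernel_integrand \<Omega> k \<phi> a z - c *\<^sub>R kernel_integrand \<Omega> k \<psi> a z)"
    by (auto simp: kernel_integrand_def fun_eq_iff indicator_def scaleR_diff_left[symmetric]) (simp add: algebra_simps)
  have "integrable (lborel \<Otimes>\<^sub>M lborel) (kernel_integrand \<Omega> k (\<lambda>x. \<phi> x - c * \<psi> x) a)"
    unfolding eq by (intro Bochner_Integration.integrable_diff integrable_scaleR_right I)
  from kernel_form_eq[OF \<open>open \<Omega>\<close> this] show ?thesis
    unfolding eq using I by (simp add: kernel_form_eq[OF \<open>open \<Omega>\<close>])
qed

lemma kernel_form_diff_inner:
  fixes a :: "real^'n \<Rightarrow> real^'n \<Rightarrow> real" and b :: "real^'n \<Rightarrow> real^'n \<Rightarrow> 'b::euclidean_space"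
  assumes "open \<Omega>" and I: "integrable (lborel \<Otimes>\<^sub>M lborel) (kernel_integrand \<Omega> k \<phi> a)"
      "integrable (lborel \<Otimes>\<^sub>M lborel) (kernel_integrand \<Omega> k \<phi> b)"
  shows "kernel_form \<Omega> k \<phi> (\<lambda>x y. a x y - G \<bullet> b x y) = kernel_form \<Omega> k \<phi> a - G \<bullet> kernel_form \<Omega> k \<phi> b"
proof -
  have eq: "kernel_integrand \<Omega> k \<phi> (\<lambda>x y. a x y - G \<bullet> b x y)
      = (\<lambda>z. kernel_integrand \<Omega> k \<phi> a z - G \<bullet> kernel_integrand \<Omega> k \<phi> b z)"
    by (auto simp: kernel_integrand_def fun_eq_iff algebra_simps)
  have "integrable (lborel \<Otimes>\<^sub>M lborel) (kernel_integrand \<Omega> k \<phi> (\<lambda>x y. a x y - G \<bullet> b x y))"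
    unfolding eq by (intro Bochner_Integration.integrable_diff integrable_inner_right I)
  from kernel_form_eq[OF \<open>open \<Omega>\<close> this] show ?thesis
    unfolding eq using I by (simp add: kernel_form_eq[OF \<open>open \<Omega>\<close>])
qed

text \<open>
  For the test function \<open>\<phi>\<^sub>\<delta> - c \<phi>\<^sub>1\<close> with \<open>c = \<integral> \<phi>\<^sub>\<delta> / \<integral> \<phi>\<^sub>1\<close>, the weak equation expresses the form at
  \<open>\<phi>\<^sub>\<delta>\<close> by \<open>\<integral> g \<phi>\<^sub>\<delta>\<close> and by \<open>c\<close> times a number that does not depend on \<open>\<delta>\<close>. Both are of lower order
  than \<open>\<delta>\<^bsup>n+1-\<alpha>\<^esup>\<close>.
\<close>

lemma weak_solution_tent_limit:
  fixes u g :: "real^'n \<Rightarrow> real"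
  assumes "open \<Omega>" and k: "singular_kernel \<alpha> K k" and \<alpha>: "1 < \<alpha>" "\<alpha> < 2"
    and p: "1 \<le> p" "ereal (real CARD('n)) / p < ereal (\<alpha> - 1)" and g: "g \<in> Lp p \<Omega>"
    and weak: "\<And>\<psi>. \<psi> \<in> Hs (\<alpha>/2) \<Omega> \<Longrightarrow> zero_integral \<Omega> \<psi> \<Longrightarrow>
                    energy_form \<Omega> k u \<psi> = (LINT x|lebesgue_on \<Omega>. g x * \<psi> x)"
    and u: "continuous_on (\<Omega> \<times> \<Omega>) (\<lambda>(x, y). u x - u y)"
    and M: "\<And>x y. x \<in> \<Omega> \<Longrightarrow> y \<in> \<Omega> \<Longrightarrow> \<bar>u x - u y\<bar> \<le> M * norm (x - y)" "0 \<le> M"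
    and x0: "x\<^sub>0 \<in> closure \<Omega>"
  shows "((\<lambda>\<delta>. \<delta> powr (\<alpha> - 1 - real CARD('n)) * kernel_form \<Omega> k (tent x\<^sub>0 \<delta>) (\<lambda>x y. u x - u y)) \<longlongrightarrow> 0) (at_right 0)"
proof -
  let ?n = "real CARD('n)"
  let ?V = "unit_ball_vol ?n"
  have "1 \<le> CARD('n)" by (simp add: Suc_le_eq)
  then have "\<alpha> - 1 \<le> ?n" using \<alpha> by linarith
  then obtain A s where A: "0 \<le> A" and s: "s < \<alpha> - 1"
    and g_int: "\<And>\<delta>. 0 < \<delta> \<Longrightarrow> integrable (lebesgue_on \<Omega>) (\<lambda>x. g x * tent x\<^sub>0 \<delta> x)"
    and g_le: "\<And>\<delta>. 0 < \<delta> \<Longrightarrow> \<bar>LINT x|lebesgue_on \<Omega>. g x * tent x\<^sub>0 \<delta> x\<bar> \<le> A * \<delta> powr (?n - s)"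
    by (rule Lp_tent_bound[OF \<open>open \<Omega>\<close> p _ g, where x\<^sub>0 = x\<^sub>0]) (rule that)
  define T where "T \<delta> = (LINT x|lebesgue_on \<Omega>. tent x\<^sub>0 \<delta> x)" for \<delta>
  define J where "J \<delta> = kernel_form \<Omega> k (tent x\<^sub>0 \<delta>) (\<lambda>x y. u x - u y)" for \<delta>
  define I where "I \<delta> = (LINT x|lebesgue_on \<Omega>. g x * tent x\<^sub>0 \<delta> x)" for \<delta>
  have T1: "0 < T 1" unfolding T_def by (intro integral_tent_pos \<open>open \<Omega>\<close> x0) simp
  have int: "integrable (lborel \<Otimes>\<^sub>M lborel) (kernel_integrand \<Omega> k (tent x\<^sub>0 \<delta>) (\<lambda>x y. u x - u y))" if "0 < \<delta>" for \<delta>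
    using M by (intro kernel_integrand_tent_integrable[OF \<open>open \<Omega>\<close> k \<alpha> that u, where M = M]) auto
  have J: "J \<delta> = 2 * I \<delta> + T \<delta> * ((J 1 - 2 * I 1) / T 1)" if \<delta>: "0 < \<delta>" for \<delta>
  proof -
    define c where "c = T \<delta> / T 1"
    let ?\<psi> = "\<lambda>x. tent x\<^sub>0 \<delta> x - c * tent x\<^sub>0 1 x"
    have t: "integrable (lebesgue_on \<Omega>) (tent x\<^sub>0 \<delta>)" "integrable (lebesgue_on \<Omega>) (tent x\<^sub>0 1)"
      using \<delta> by (auto intro: integrable_tent \<open>open \<Omega>\<close>)
    have "zero_integral \<Omega> ?\<psi>"
      unfolding zero_integral_def using t T1 by (simp add: T_def[symmetric] c_def)
    then have "energy_form \<Omega> k u ?\<psi> = (LINT x|lebesgue_on \<Omega>. g x * ?\<psi> x)"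
      by (intro weak tent_combination_in_Hs \<open>open \<Omega>\<close> \<alpha> \<delta>)
    also have "\<dots> = (LINT x|lebesgue_on \<Omega>. g x * tent x\<^sub>0 \<delta> x - c * (g x * tent x\<^sub>0 1 x))"
      by (simp add: algebra_simps)
    also have "\<dots> = I \<delta> - c * I 1"
      using g_int[OF \<delta>] g_int[of 1] by (simp add: I_def)
    also have "energy_form \<Omega> k u ?\<psi> = 1/2 * (J \<delta> - c * J 1)"
      unfolding energy_form_eq_kernel_form J_def
      using kernel_form_diff_left[OF \<open>open \<Omega>\<close> int[OF \<delta>] int[of 1], of c] by simp
    finally have "J \<delta> = 2 * I \<delta> + c * (J 1 - 2 * I 1)"
      by (simp add: right_diff_distrib)
    then show ?thesis by (simp add: c_def)
  qed
  define B where "B = ?V * \<bar>(J 1 - 2 * I 1) / T 1\<bar>"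
  have bound: "\<bar>\<delta> powr (\<alpha> - 1 - ?n) * J \<delta>\<bar> \<le> 2 * A * \<delta> powr (\<alpha> - 1 - s) + B * \<delta> powr (\<alpha> - 1)" if \<delta>: "0 < \<delta>" for \<delta>
  proof -
    have "\<bar>J \<delta>\<bar> \<le> 2 * \<bar>I \<delta>\<bar> + \<bar>T \<delta>\<bar> * \<bar>(J 1 - 2 * I 1) / T 1\<bar>"
      unfolding J[OF \<delta>] using abs_triangle_ineq[of "2 * I \<delta>" "T \<delta> * ((J 1 - 2 * I 1) / T 1)"] by (simp add: abs_mult)
    also have "\<dots> \<le> 2 * (A * \<delta> powr (?n - s)) + (?V * \<delta> ^ CARD('n)) * \<bar>(J 1 - 2 * I 1) / T 1\<bar>"
      unfolding I_def T_def by (intro add_mono mult_left_mono mult_right_mono g_le integrable_tent \<open>open \<Omega>\<close> \<delta>) auto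
    finally have "\<bar>\<delta> powr (\<alpha> - 1 - ?n) * J \<delta>\<bar>
        \<le> \<delta> powr (\<alpha> - 1 - ?n) * (2 * (A * \<delta> powr (?n - s)) + (?V * \<delta> ^ CARD('n)) * \<bar>(J 1 - 2 * I 1) / T 1\<bar>)"
      by (simp add: abs_mult mult_left_mono)
    also have "\<dots> = 2 * A * (\<delta> powr (\<alpha> - 1 - ?n) * \<delta> powr (?n - s)) + B * (\<delta> powr (\<alpha> - 1 - ?n) * \<delta> ^ CARD('n))"
      by (simp add: B_def algebra_simps)
    also have "\<delta> powr (\<alpha> - 1 - ?n) * \<delta> ^ CARD('n) = \<delta> powr (\<alpha> - 1)"
      using \<delta> by (simp add: powr_realpow[symmetric] powr_add[symmetric])
    also have "\<delta> powr (\<alpha> - 1 - ?n) * \<delta> powr (?n - s) = \<delta> powr (\<alpha> - 1 - s)"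
      by (simp add: powr_add[symmetric] algebra_simps)
    finally show ?thesis .
  qed
  have "((\<lambda>\<delta>. 2 * A * \<delta> powr (\<alpha> - 1 - s) + B * \<delta> powr (\<alpha> - 1)) \<longlongrightarrow> 2 * A * 0 + B * 0) (at_right 0)"
    using s \<alpha> by (intro tendsto_intros tendsto_powr_at_right_0) auto
  then have "((\<lambda>\<delta>. 2 * A * \<delta> powr (\<alpha> - 1 - s) + B * \<delta> powr (\<alpha> - 1)) \<longlongrightarrow> 0) (at_right 0)"
    by simp
  moreover have "\<forall>\<^sub>F \<delta> in at_right 0. norm (\<delta> powr (\<alpha> - 1 - ?n) * J \<delta>)
      \<le> 2 * A * \<delta> powr (\<alpha> - 1 - s) + B * \<delta> powr (\<alpha> - 1)"
    using eventually_at_right_less by eventually_elim (simp only: real_norm_def bound)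
  ultimately have "((\<lambda>\<delta>. \<delta> powr (\<alpha> - 1 - ?n) * J \<delta>) \<longlongrightarrow> 0) (at_right 0)"
    by (rule Lim_null_comparison[rotated])
  then show ?thesis by (simp add: J_def)
qed

lemma kernel_integrand_moment_integrable:
  fixes x\<^sub>0 :: "real^'n"
  assumes "open \<Omega>" "singular_kernel \<alpha> K k" "1 < \<alpha>" "\<alpha> < 2" "0 < \<delta>"
  shows "integrable (lborel \<Otimes>\<^sub>M lborel) (kernel_integrand \<Omega> k (tent x\<^sub>0 \<delta>) (\<lambda>x y. x - y))"
  by (rule kernel_integrand_tent_integrable[OF assms, where M = 1])
     (auto simp: case_prod_unfold intro!: continuous_intros)

text \<open>
  By linearity, \<open>G\<close> paired with the moment is the form at \<open>u\<close> minus the form at the error of the linear approximation; after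
  scaling, both tend to zero.
\<close>

lemma gradient_inner_moment_tendsto_0:
  fixes u g :: "real^'n \<Rightarrow> real"
  assumes "open \<Omega>" "convex \<Omega>" and k: "singular_kernel \<alpha> K k" and \<alpha>: "1 < \<alpha>" "\<alpha> < 2"
    and p: "1 \<le> p" "ereal (real CARD('n)) / p < ereal (\<alpha> - 1)" and g: "g \<in> Lp p \<Omega>"
    and weak: "\<And>\<psi>. \<psi> \<in> Hs (\<alpha>/2) \<Omega> \<Longrightarrow> zero_integral \<Omega> \<psi> \<Longrightarrow>
                    energy_form \<Omega> k u \<psi> = (LINT x|lebesgue_on \<Omega>. g x * \<psi> x)"
    and u: "\<And>x. x \<in> \<Omega> \<Longrightarrow> GDERIV u x :> D x" and M: "\<And>x. x \<in> \<Omega> \<Longrightarrow> norm (D x) \<le> M"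
    and x0: "x\<^sub>0 \<in> frontier \<Omega>" and lim: "(D \<longlongrightarrow> G) (at x\<^sub>0 within \<Omega>)"
  shows "((\<lambda>\<delta>. G \<bullet> scaled_tent_moment \<alpha> \<Omega> k x\<^sub>0 \<delta>) \<longlongrightarrow> 0) (at_right 0)"
proof -
  let ?n = "real CARD('n)"
  let ?s = "\<lambda>\<delta>. \<delta> powr (\<alpha> - 1 - ?n)"
  let ?J = "\<lambda>\<delta>. kernel_form \<Omega> k (tent x\<^sub>0 \<delta>) (\<lambda>x y. u x - u y)"
  let ?E = "\<lambda>\<delta>. kernel_form \<Omega> k (tent x\<^sub>0 \<delta>) (\<lambda>x y. u x - u y - G \<bullet> (x - y))"
  have x0': "x\<^sub>0 \<in> closure \<Omega>" "x\<^sub>0 \<notin> \<Omega>"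
    using x0 \<open>open \<Omega>\<close> by (auto simp: frontier_def interior_open)
  have lip: "\<bar>u x - u y\<bar> \<le> \<bar>M\<bar> * norm (x - y)" if "x \<in> \<Omega>" "y \<in> \<Omega>" for x y
    using GDERIV_linear_approx[OF \<open>convex \<Omega>\<close> u _ that, of 0 "\<bar>M\<bar>"] M by force
  have cont: "continuous_on (\<Omega> \<times> \<Omega>) (\<lambda>(x, y). u x - u y)"
    by (rule continuous_on_GDERIV_diff[OF u])
  have "((\<lambda>\<delta>. ?s \<delta> * ?J \<delta> - ?s \<delta> * ?E \<delta>) \<longlongrightarrow> 0 - 0) (at_right 0)"
    by (intro tendsto_diff weak_solution_tent_limit[OF \<open>open \<Omega>\<close> k \<alpha> p g weak cont lip _ x0'(1)]
        kernel_form_linearisation_error[OF \<open>open \<Omega>\<close> \<open>convex \<Omega>\<close> k \<alpha> u M x0'(2) lim]) auto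
  moreover have "\<forall>\<^sub>F \<delta> in at_right 0. ?s \<delta> * ?J \<delta> - ?s \<delta> * ?E \<delta> = G \<bullet> scaled_tent_moment \<alpha> \<Omega> k x\<^sub>0 \<delta>"
    using eventually_at_right_less
  proof eventually_elim
    case (elim \<delta>)
    have "integrable (lborel \<Otimes>\<^sub>M lborel) (kernel_integrand \<Omega> k (tent x\<^sub>0 \<delta>) (\<lambda>x y. u x - u y))"
      using lip by (intro kernel_integrand_tent_integrable[OF \<open>open \<Omega>\<close> k \<alpha> elim cont, where M = "\<bar>M\<bar>"]) auto
    from kernel_form_diff_inner[OF \<open>open \<Omega>\<close> this kernel_integrand_moment_integrable[OF \<open>open \<Omega>\<close> k \<alpha> elim]]
    show ?case by (simp add: scaled_tent_moment_eq right_diff_distrib)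
  qed
  ultimately show ?thesis
    using tendsto_cong by force
qed

section \<open>The half-space and dimension one\<close>

lemma half_space_open: "open half_space"
  unfolding half_space_def by (rule open_halfspace_component_gt_cart)

lemma half_space_convex: "convex half_space"
  unfolding half_space_def by (auto simp: convex_def) (smt (verit) mult_nonneg_nonneg mult_pos_pos)

lemma frontier_half_space:
  fixes x :: "real^'n::{finite,linorder}"
  assumes x: "x \<in> frontier half_space"
  shows "x $ Max UNIV = 0"
proof -
  from x have "\<not> 0 < x $ Max UNIV"
    by (simp add: frontier_def interior_open[OF half_space_open]) (simp add: half_space_def)
  moreover have "closure half_space \<subseteq> {x::real^'n::{finite,linorder}. 0 \<le> x $ Max UNIV}"
    by (rule closure_minimal) (auto simp: half_space_def closed_halfspace_component_ge_cart)
  ultimately show ?thesis using x by (auto simp: frontier_def)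
qed

text \<open>
  The half-space is a half-line with end point \<open>x\<^sub>0\<close>, on which the tent is decreasing; hence the integrand
  of the moment has a sign. It suffices to bound it for \<open>x\<close> in the left and
  \<open>y\<close> in the right half of the interval of length \<open>\<delta>\<close>. There \<open>\<phi>\<^sub>\<delta>\<close> has slope \<open>-1/\<delta>\<close>, so that the integrand is
  at least \<open>k0 \<bar>x - y\<bar>\<^bsup>1-\<alpha>\<^esup> / \<delta> \<ge> k0 \<delta>\<^bsup>-\<alpha>\<^esup>\<close> in absolute value, and the product of the two halves has measure \<open>\<delta>\<^sup>2/4\<close>.
\<close>

lemma one_dim_moment_bound:
  fixes x\<^sub>0 :: "real^'n::{finite,linorder}"
  assumes n: "CARD('n) = 1" and k: "singular_kernel \<alpha> K k" and \<alpha>: "1 < \<alpha>" "\<alpha> < 2"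
    and k0: "0 \<le> k0" "\<And>x y. x \<noteq> y \<Longrightarrow> k0 * norm (x - y) powr (- real CARD('n) - \<alpha>) \<le> k x y (x - y)"
    and x0: "x\<^sub>0 \<in> frontier half_space" and \<delta>: "0 < \<delta>"
  shows "1 \<bullet> scaled_tent_moment \<alpha> half_space k x\<^sub>0 \<delta> \<le> - k0 / 4"
proof -
  define i :: 'n where "i = Max UNIV"
  obtain i' where "(UNIV :: 'n set) = {i'}" using n card_1_singletonE by blast
  then have UNIV_i: "(UNIV :: 'n set) = {i}" by (metis UNIV_I singletonD)
  have norm_eq: "norm z = \<bar>z $ i\<bar>" for z :: "real^'n::{finite,linorder}"
    by (simp add: norm_vec_def UNIV_i L2_set_def)
  have inner_1: "1 \<bullet> z = z $ i" for z :: "real^'n::{finite,linorder}"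
    by (simp add: inner_vec_def UNIV_i)
  have x0i: "x\<^sub>0 $ i = 0" using frontier_half_space[OF x0] by (simp add: i_def)
  let ?\<Omega> = "half_space :: (real^'n::{finite,linorder}) set"
  let ?F = "kernel_integrand ?\<Omega> k (tent x\<^sub>0 \<delta>) (\<lambda>x y. x - y)"
  note I = kernel_integrand_moment_integrable[OF half_space_open k \<alpha> \<delta>, of x\<^sub>0]
  \<comment> \<open>the two halves of the interval, as balls: being disjoint, they avoid the diagonal\<close>
  define B1 where "B1 = ball (x\<^sub>0 + (\<delta>/4) *\<^sub>R 1) (\<delta>/4)"
  define B2 where "B2 = ball (x\<^sub>0 + (3*\<delta>/4) *\<^sub>R 1) (\<delta>/4)"
  have B: "x \<in> B1 \<longleftrightarrow> 0 < x $ i \<and> x $ i < \<delta>/2" "x \<in> B2 \<longleftrightarrow> \<delta>/2 < x $ i \<and> x $ i < \<delta>" for x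
    unfolding B1_def B2_def mem_ball dist_norm norm_eq by (auto simp: x0i abs_if)
  have em: "emeasure lborel B1 = ennreal (\<delta>/2)" "emeasure lborel B2 = ennreal (\<delta>/2)"
    unfolding B1_def B2_def using \<delta> by (simp_all add: emeasure_ball n)
  have [simp]: "B1 \<in> sets borel" "B2 \<in> sets borel" by (auto simp: B1_def B2_def)
  have em2: "emeasure (lborel \<Otimes>\<^sub>M lborel) (B1 \<times> B2) = ennreal (\<delta>\<^sup>2 / 4)"
    using \<delta> by (subst lborel.emeasure_pair_measure_Times) (auto simp: em ennreal_mult'[symmetric] power2_eq_square)
  let ?c = "k0 * \<delta> powr (- \<alpha>)"
  have pt: "?c * indicator (B1 \<times> B2) z \<le> - (1 \<bullet> ?F z)" for z
  proof -
    obtain x y where z: "z = (x, y)" by (cases z)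
    show ?thesis
    proof (cases "x \<in> ?\<Omega> \<and> y \<in> ?\<Omega> \<and> x \<noteq> y")
      case False
      then have "indicator (B1 \<times> B2) z = (0::real)"
        by (auto simp: z indicator_def B half_space_def i_def[symmetric])
      moreover have "?F z = 0"
        using False by (auto simp: z kernel_integrand_def)
      ultimately show ?thesis by simp
    next
      case True
      then have xy: "0 < x $ i" "0 < y $ i" "x \<noteq> y"
        by (auto simp: half_space_def i_def)
      let ?d = "x $ i - y $ i"
      let ?t = "tent x\<^sub>0 \<delta>"
      have t: "?t w = max 0 (1 - w $ i / \<delta>)" if "0 < w $ i" for w
        using that \<delta> by (simp add: tent_eq_max norm_eq x0i)
      have eq: "- (1 \<bullet> ?F z) = - ((?t x - ?t y) * ?d) * k x y (x - y)"
        using True by (simp add: z kernel_integrand_def inner_1)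
      have k: "k0 * \<bar>?d\<bar> powr (- 1 - \<alpha>) \<le> k x y (x - y)"
        using k0(2)[OF xy(3)] by (simp add: norm_eq n)
      have k_nn: "0 \<le> k x y (x - y)"
        by (rule order_trans[OF _ k]) (use k0(1) in simp)
      show ?thesis
      proof (cases "x \<in> B1 \<and> y \<in> B2")
        case True
        then have d: "0 < \<bar>?d\<bar>" "\<bar>?d\<bar> \<le> \<delta>" using \<delta> by (auto simp: B)
        have "\<delta> powr (- \<alpha>) = \<delta> powr (1 - \<alpha>) / \<delta>"
          using \<delta> powr_diff[of \<delta> "1 - \<alpha>" 1] by simp
        also have "\<dots> \<le> \<bar>?d\<bar> powr (1 - \<alpha>) / \<delta>"
          using d \<delta> \<alpha> by (intro divide_right_mono powr_mono2') auto
        also have "\<bar>?d\<bar> powr (1 - \<alpha>) = \<bar>?d\<bar> powr 2 * \<bar>?d\<bar> powr (- 1 - \<alpha>)"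
          by (simp only: powr_add[symmetric]) simp
        also have "\<bar>?d\<bar> powr 2 = ?d\<^sup>2"
          using d by (simp add: powr_numeral)
        finally have "?c \<le> k0 * (?d\<^sup>2 * \<bar>?d\<bar> powr (- 1 - \<alpha>) / \<delta>)"
          using k0(1) by (rule mult_left_mono)
        also have "\<dots> = ?d\<^sup>2 / \<delta> * (k0 * \<bar>?d\<bar> powr (- 1 - \<alpha>))" by simp
        also have "\<dots> \<le> ?d\<^sup>2 / \<delta> * k x y (x - y)"
          using \<delta> k by (intro mult_left_mono) auto
        also have "?d\<^sup>2 / \<delta> = - ((?t x - ?t y) * ?d)"
        proof -
          have "?t x = 1 - x $ i / \<delta>" "?t y = 1 - y $ i / \<delta>"
            using True \<delta> unfolding t[OF xy(1)] t[OF xy(2)] by (auto simp: B max_absorb2)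
          then have "?t x - ?t y = - (?d / \<delta>)" by (simp add: diff_divide_distrib)
          then show ?thesis by (simp add: power2_eq_square)
        qed
        finally show ?thesis using True eq by (simp add: z)
      next
        case False
        have "(?t x - ?t y) * ?d \<le> 0"
        proof (cases "x $ i \<le> y $ i")
          case True
          then have "?t y \<le> ?t x" unfolding t[OF xy(1)] t[OF xy(2)] using \<delta> by (intro max.mono) (auto simp: divide_right_mono)
          with True show ?thesis by (simp add: mult_nonneg_nonpos)
        next
          case False
          then have "?t x \<le> ?t y" unfolding t[OF xy(1)] t[OF xy(2)] using \<delta> by (intro max.mono) (auto simp: divide_right_mono)
          with False show ?thesis by (simp add: mult_nonpos_nonneg)
        qed
        then have "0 \<le> - (1 \<bullet> ?F z)" unfolding eq using k_nn by (intro mult_nonneg_nonneg) auto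
        with False show ?thesis by (auto simp: z)
      qed
    qed
  qed
  have "?c * (\<delta>\<^sup>2 / 4) = (LINT z|(lborel \<Otimes>\<^sub>M lborel). ?c * indicator (B1 \<times> B2) z)"
    using em2 by (simp add: measure_def)
  also have "\<dots> \<le> (LINT z|(lborel \<Otimes>\<^sub>M lborel). - (1 \<bullet> ?F z))"
  proof (rule integral_mono)
    show "integrable (lborel \<Otimes>\<^sub>M lborel) (\<lambda>z. ?c * indicator (B1 \<times> B2) z)"
      using em2 by (intro integrable_mult_right integrable_real_indicator) auto
    show "integrable (lborel \<Otimes>\<^sub>M lborel) (\<lambda>z. - (1 \<bullet> ?F z))"
      by (intro Bochner_Integration.integrable_minus integrable_inner_right I)
  qed (rule pt)
  also have "\<dots> = - (1 \<bullet> kernel_form ?\<Omega> k (tent x\<^sub>0 \<delta>) (\<lambda>x y. x - y))"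
    using I by (simp add: kernel_form_eq[OF half_space_open I])
  finally have "\<delta> powr (\<alpha> - 2) * (?c * (\<delta>\<^sup>2 / 4)) \<le> \<delta> powr (\<alpha> - 2) * - (1 \<bullet> kernel_form ?\<Omega> k (tent x\<^sub>0 \<delta>) (\<lambda>x y. x - y))"
    by (intro mult_left_mono) auto
  moreover have "\<delta> powr (\<alpha> - 2) * (?c * (\<delta>\<^sup>2 / 4)) = k0 / 4 * (\<delta> powr (\<alpha> - 2) * \<delta> powr (- \<alpha>) * \<delta> powr 2)"
    using \<delta> by (simp add: powr_numeral)
  moreover have "\<delta> powr (\<alpha> - 2) * \<delta> powr (- \<alpha>) * \<delta> powr 2 = 1"
    using \<delta> by (simp only: powr_add[symmetric]) simp
  ultimately have "k0 / 4 \<le> \<delta> powr (\<alpha> - 2) * - (1 \<bullet> kernel_form ?\<Omega> k (tent x\<^sub>0 \<delta>) (\<lambda>x y. x - y))"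
    by (simp only: mult_1_right)
  then show ?thesis
    by (simp add: scaled_tent_moment_eq n)
qed

lemma admissible_kernel_singular:
  fixes k :: "real^'n::{finite,linorder} \<Rightarrow> real^'n::{finite,linorder} \<Rightarrow> real^'n::{finite,linorder} \<Rightarrow> real"
  assumes "admissible_kernel \<alpha> k"
  obtains k0 K0 where "singular_kernel \<alpha> K0 k" "0 < k0"
    "\<And>x y. x \<noteq> y \<Longrightarrow> k0 * norm (x - y) powr (- real CARD('n) - \<alpha>) \<le> k x y (x - y)"
proof -
  let ?n = "CARD('n)"
  obtain k0 K0 where k: "0 < k0" "k0 \<le> K0"
    and bd: "\<And>x y z. z \<noteq> 0 \<Longrightarrow> k0 * norm z powr (- real ?n - \<alpha>) \<le> k x y z \<and>
               k x y z \<le> K0 * norm z powr (- real ?n - \<alpha>)"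
    using assms unfolding admissible_kernel_def Let_def by blast
  have "Ck (?n + 2) (UNIV \<times> UNIV \<times> (- {0})) (\<lambda>(x, y, z). k x y z)"
    using assms unfolding admissible_kernel_def Let_def by blast
  then have c: "continuous_on (UNIV \<times> UNIV \<times> (- {0})) (\<lambda>(x, y, z). k x y z)"
    by (simp add: numeral_2_eq_2)
  have "continuous_on {(x, y). x \<noteq> y} (\<lambda>z. case (fst z, snd z, fst z - snd z) of (x, y, z) \<Rightarrow> k x y z)"
    by (rule continuous_on_compose2[OF c]) (auto intro!: continuous_intros)
  then have "continuous_on {(x, y). x \<noteq> y} (\<lambda>(x, y). k x y (x - y))"
    by (simp add: case_prod_unfold)
  moreover have "\<bar>k x y (x - y)\<bar> \<le> K0 * norm (x - y) powr (- real ?n - \<alpha>)" if "x \<noteq> y" for x y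
  proof -
    have "0 \<le> k0 * norm (x - y) powr (- real ?n - \<alpha>)" using k by simp
    then show ?thesis using bd[of "x - y" x y] that by auto
  qed
  ultimately have "singular_kernel \<alpha> K0 k"
    using k by (simp add: singular_kernel_def)
  with k(1) bd show thesis by (intro that[of K0 k0]) auto
qed

theorem theorem6p1:
  fixes k :: "real^'n::{finite,linorder} \<Rightarrow> real^'n::{finite,linorder} \<Rightarrow> real^'n::{finite,linorder} \<Rightarrow> real"
    and \<Omega> :: "(real^'n::{finite,linorder}) set"
    and u g :: "real^'n::{finite,linorder} \<Rightarrow> real"
    and \<nu> :: "real^'n::{finite,linorder} \<Rightarrow> real^'n::{finite,linorder}"
    and \<alpha> \<beta> :: real and p :: ereal
  assumes \<Omega>: "\<Omega> = half_space"
    and p: "1 \<le> p" "ereal (real CARD('n)) / p < ereal (\<alpha> - 1)"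
    and \<alpha>: "3/2 < \<alpha>" "\<alpha> < 2"
    and k: "admissible_kernel \<alpha> k"
    and u: "u \<in> Hs (\<alpha>/2) \<Omega>" "zero_mean \<Omega> u" "u \<in> Hs1_loc \<alpha> \<Omega>"
    and g: "g \<in> Lp p \<Omega>" "zero_mean \<Omega> g"
    and weak_eq: "\<forall>\<psi>\<in>Hs (\<alpha>/2) \<Omega>. zero_integral \<Omega> \<psi> \<longrightarrow>
                    energy_form \<Omega> k u \<psi> = (LINT x|lebesgue_on \<Omega>. g x * \<psi> x)"
    and \<beta>: "0 < \<beta>" "\<beta> < 1"
    and u_C1: "u \<in> C1_hoelder \<beta> \<Omega>"
    and \<nu>_dim_ge_2: "2 \<le> CARD('n) \<Longrightarrow>
          \<forall>x\<^sub>0\<in>frontier \<Omega>. (scaled_tent_moment \<alpha> \<Omega> k x\<^sub>0 \<longlongrightarrow> \<nu> x\<^sub>0) (at_right 0) \<and> \<nu> x\<^sub>0 \<noteq> 0"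
    and \<nu>_dim_1: "CARD('n) = 1 \<Longrightarrow> \<forall>x\<^sub>0\<in>frontier \<Omega>. \<nu> x\<^sub>0 = 1"
  shows "\<forall>x\<^sub>0\<in>frontier \<Omega>. boundary_grad \<Omega> u x\<^sub>0 \<bullet> \<nu> x\<^sub>0 = 0"
proof
  fix x\<^sub>0 assume x0: "x\<^sub>0 \<in> frontier \<Omega>"
  have op: "open \<Omega>" and conv: "convex \<Omega>"
    by (simp_all add: \<Omega> half_space_open half_space_convex)
  have \<alpha>1: "1 < \<alpha>" using \<alpha> by simp
  obtain k0 K0 where sk: "singular_kernel \<alpha> K0 k" and k0: "0 < k0"
    and lower: "\<And>x y. x \<noteq> y \<Longrightarrow> k0 * norm (x - y) powr (- real CARD('n) - \<alpha>) \<le> k x y (x - y)"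
    using admissible_kernel_singular[OF k] by metis
  define G where "G = boundary_grad \<Omega> u x\<^sub>0"
  have u': "\<And>x. x \<in> \<Omega> \<Longrightarrow> GDERIV u x :> grad u x"
    using u_C1 by (simp add: C1_hoelder_def)
  obtain M where M: "\<And>x. x \<in> \<Omega> \<Longrightarrow> norm (grad u x) \<le> M"
  proof -
    have "bounded (grad u ` \<Omega>)" using u_C1 by (simp add: C1_hoelder_def)
    then show thesis using that by (auto simp: bounded_iff)
  qed
  obtain l where l: "(grad u \<longlongrightarrow> l) (at x\<^sub>0 within \<Omega>)"
    using u_C1 x0 by (auto simp: C1_hoelder_def)
  have "x\<^sub>0 islimpt \<Omega>"
    using x0 op by (auto simp: frontier_def interior_open closure_def)
  then have "G = l"
    unfolding G_def boundary_grad_def by (intro tendsto_Lim l) (simp add: trivial_limit_within)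
  with l have G: "(grad u \<longlongrightarrow> G) (at x\<^sub>0 within \<Omega>)" by simp
  have lim: "((\<lambda>\<delta>. G \<bullet> scaled_tent_moment \<alpha> \<Omega> k x\<^sub>0 \<delta>) \<longlongrightarrow> 0) (at_right 0)"
    using weak_eq by (intro gradient_inner_moment_tendsto_0[OF op conv sk \<alpha>1 \<alpha>(2) p g(1) _ u' M x0 G]) auto
  show "G \<bullet> \<nu> x\<^sub>0 = 0"
  proof (cases "CARD('n) = 1")
    case False
    then have "2 \<le> CARD('n)"
      using zero_less_card_finite[where 'a = 'n] by linarith
    then have "((\<lambda>\<delta>. G \<bullet> scaled_tent_moment \<alpha> \<Omega> k x\<^sub>0 \<delta>) \<longlongrightarrow> G \<bullet> \<nu> x\<^sub>0) (at_right 0)"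
      using \<nu>_dim_ge_2 x0 by (intro tendsto_inner tendsto_const) auto
    from tendsto_unique[OF _ this lim] show ?thesis by simp
  next
    case True
    then obtain i where i: "(UNIV :: 'n set) = {i}" using card_1_singletonE by blast
    have inner: "G \<bullet> z = (G \<bullet> 1) * (1 \<bullet> z)" for z
      by (simp add: inner_vec_def i)
    have "G \<bullet> 1 = 0"
    proof (rule ccontr)
      assume "G \<bullet> 1 \<noteq> 0"
      moreover from this have "((\<lambda>\<delta>. G \<bullet> scaled_tent_moment \<alpha> \<Omega> k x\<^sub>0 \<delta> / (G \<bullet> 1)) \<longlongrightarrow> 0 / (G \<bullet> 1)) (at_right 0)"
        by (intro tendsto_divide lim tendsto_const)
      ultimately have "((\<lambda>\<delta>. 1 \<bullet> scaled_tent_moment \<alpha> \<Omega> k x\<^sub>0 \<delta>) \<longlongrightarrow> 0) (at_right 0)"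
        by (subst (asm) inner) simp
      moreover have "\<forall>\<^sub>F \<delta> in at_right 0. 1 \<bullet> scaled_tent_moment \<alpha> \<Omega> k x\<^sub>0 \<delta> \<le> - k0 / 4"
        using eventually_at_right_less
        by eventually_elim
           (use one_dim_moment_bound[OF True sk \<alpha>1 \<alpha>(2) less_imp_le[OF k0] lower] x0 \<Omega> in auto)
      ultimately have "0 \<le> - k0 / 4"
        by (intro tendsto_upperbound) auto
      with k0 show False by simp
    qed
    with True \<nu>_dim_1 x0 show ?thesis by simp
  qed
qed

end
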